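(* Let $q,q_0,q_1>1$ be real. For the rank 1 affine Hecke algebras (1) $\tilde A_1(q)$ with $L=Q$, (2) $\tilde A_1(q)$ with $L=P$, (3) $\widetilde{BC}_1(q_0,q_1)$ with $L=Q$, and with the representations described in the context, we have for all $h\in\mathscr{H}$, respectively: $$\mathrm{Tr}(h)=\frac{1}{2q}\int_{\mathbb{T}}\frac{\chi_t(h)}{|c(t)|^2}\,dt+\frac{q-1}{q+1}\chi(h),$$ $$\mathrm{Tr}(h)=\frac{1}{2q}\int_{\mathbb{T}}\frac{\chi_t(h)}{|c(t)|^2}\,dt+\frac{q-1}{2(q+1)}\left(\chi^{1}(h)+\chi^{2}(h)\right),$$ $$\mathrm{Tr}(h)=\frac{1}{2q_1}\int_{\mathbb{T}}\frac{\chi_t(h)}{|c(t)|^2}\,dt+\frac{q_0q_1-1}{(q_0+1)(q_1+1)}\chi^{1}(h)+\frac{|q_0-q_1|}{(q_0+1)(q_1+1)}\times\begin{cases}\chi^2(h)&\text{if }q_0<q_1\\ \chi^3(h)&\text{if }q_1<q_0\end{cases}$$ (the last term being $0$ if $q_0=q_1$), where the $c$-functions are respectively $$c(t)=\frac{1-q^{-1}t^{-1}}{1-t^{-1}},\qquad c(t)=\frac{1-q^{-1}t^{-2}}{1-t^{-2}},\qquad c(t)=\frac{(1-q_0^{-1/2}q_1^{-1/2}t^{-1})(1+q_0^{1/2}q_1^{-1/2}t^{-1})}{1-t^{-2}}.$$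
   Context: $\mathbb{T}=\{z\in\mathbb{C}:|z|=1\}$ with normalised Haar measure $dt$. In all cases $\mathscr{H}$ has a vector space basis $\{T_w\}$ indexed by an (extended) affine Weyl group $W$, with $T_uT_v=T_{uv}$ if $\ell(uv)=\ell(u)+\ell(v)$ and $T_i^2=1+(q_i^{1/2}-q_i^{-1/2})T_i$ for the Coxeter generators ($T_i=T_{s_i}$), and $\mathrm{Tr}(\sum_w c_wT_w)=c_1$ (coefficient of the identity). Positive square roots are used. In each case the principal series representation $\pi_t$ ($t\in\mathbb{C}^\times$) is the 2-dimensional representation induced to $\mathscr{H}$ from the one-dimensional representation $x\cdot v_t=tv_t$ of the commutative subalgebra $\mathbb{C}[x^{\pm1}]$, and $\chi_t$ is its character. (1) $\tilde A_1(q)$, $L=Q$: $W=\langle s_0,s_1\rangle$ is the infinite dihedral group, $q_0=q_1=q$. $\mathscr{H}$ is generated by $T=T_1$ and the invertible element $x=x^{\alpha_1^\vee}=T_0T_1$, with relations $T^2=1+(q^{1/2}-q^{-1/2})T$ and $Tx=x^{-1}T+(q^{1/2}-q^{-1/2})(1+x)$. $\chi$ is the character of the 1-dimensional representation $\pi(T)=-q^{-1/2}$, $\pi(x)=q^{-1}$. (2) $\tilde A_1(q)$, $L=P$: $W$ is the infinite dihedral group of (1) extended by an element $\gamma$ of order 2 and length 0 interchanging $s_0$ and $s_1$ by conjugation, $q_0=q_1=q$. $\mathscr{H}$ is generated by $T=T_1$ and $x=x^{\omega_1}=T_\gamma T_1$ (with inverse), with relations $T^2=1+(q^{1/2}-q^{-1/2})T$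 and $Tx=x^{-1}T+(q^{1/2}-q^{-1/2})x$. $\chi^1,\chi^2$ are the characters of the 1-dimensional representations $\pi^1(T)=-q^{-1/2},\pi^1(x)=q^{-1/2}$ and $\pi^2(T)=-q^{-1/2},\pi^2(x)=-q^{-1/2}$. (3) $\widetilde{BC}_1(q_0,q_1)$, $L=Q$: $W=\langle s_0,s_1\rangle$ is infinite dihedral with parameters $q_0,q_1$. $\mathscr{H}$ is generated by $T=T_1$ and $x=x^{\alpha_1^\vee/2}=T_0T_1$ (with inverse), with relations $T^2=1+(q_1^{1/2}-q_1^{-1/2})T$ and $Tx=x^{-1}T+(q_1^{1/2}-q_1^{-1/2})x+(q_0^{1/2}-q_0^{-1/2})$. $\chi^1,\chi^2,\chi^3$ are the characters of the 1-dimensional representations $\pi^1(T)=-q_1^{-1/2},\pi^1(x)=q_0^{-1/2}q_1^{-1/2}$; $\pi^2(T)=-q_1^{-1/2},\pi^2(x)=-q_0^{1/2}q_1^{-1/2}$; $\pi^3(T)=q_1^{1/2},\pi^3(x)=-q_0^{-1/2}q_1^{1/2}$. *)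

theory Defs
  imports "HOL-Analysis.Analysis" "HOL-Algebra.Generated_Groups"
begin

(* The infinite dihedral group as the Coxeter group with two generators and no braid relation. *)
locale dihedral_generators = group W for W (structure) +
  fixes s0 s1
  assumes s0_carrier: "s0 \<in> carrier W" and s1_carrier: "s1 \<in> carrier W"
    and s0_involution: "s0 \<otimes> s0 = \<one>" and s1_involution: "s1 \<otimes> s1 = \<one>"
    and infinite_order: "\<And>n::nat. n > 0 \<Longrightarrow> (s0 \<otimes> s1) [^] n \<noteq> \<one>"

locale infinite_dihedral = dihedral_generators +
  assumes generated: "carrier W = generate W {s0, s1}"

locale extended_infinite_dihedral = dihedral_generators +
  fixes \<gamma>
  assumes gamma_carrier: "\<gamma> \<in> carrier W"
    and gamma_notin: "\<gamma> \<notin> generate W {s0, s1}"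
    and gamma_involution: "\<gamma> \<otimes> \<gamma> = \<one>"
    and gamma_swaps: "\<gamma> \<otimes> s0 \<otimes> \<gamma> = s1"
    and generated_ext: "carrier W = generate W {s0, s1, \<gamma>}"

(* Length of w with respect to the Coxeter generators S, where the letters from \<Omega> have
   length 0: least number of letters from S in an expression of w as a word over S and \<Omega>.
   For empty \<Omega> this is the usual Coxeter length. *)
definition ext_length :: "('w, 'm) monoid_scheme \<Rightarrow> 'w set \<Rightarrow> 'w set \<Rightarrow> 'w \<Rightarrow> nat" where
  "ext_length W S \<Omega> w =
     (LEAST n. \<exists>ws. set ws \<subseteq> S \<union> \<Omega> \<and> foldr (mult W) ws (one W) = w
                  \<and> length (filter (\<lambda>u. u \<in> S) ws) = n)"

(* Integer power of a unit of a (noncommutative) ring. *)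
definition unit_powi :: "'h::ring_1 \<Rightarrow> int \<Rightarrow> 'h" where
  "unit_powi x n =
     (if n \<ge> 0 then x ^ nat n else (THE y. x * y = 1 \<and> y * x = 1) ^ nat (- n))"

locale complex_algebra = vector_space scale
  for scale :: "complex \<Rightarrow> 'h::ring_1 \<Rightarrow> 'h" +
  assumes scale_mult_left: "scale c a * b = scale c (a * b)"
    and scale_mult_right: "a * scale c b = scale c (a * b)"
begin

(* The finite set B maps bijectively onto a basis of the quotient of the whole space by N. *)
definition basis_mod :: "'h set \<Rightarrow> 'h set \<Rightarrow> bool" where
  "basis_mod N B \<longleftrightarrow> finite B \<and>
     (\<forall>v. \<exists>!c. (\<forall>b. b \<notin> B \<longrightarrow> c b = 0) \<and> v - (\<Sum>b\<in>B. scale (c b) b) \<in> N)"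

definition coords_mod :: "'h set \<Rightarrow> 'h set \<Rightarrow> 'h \<Rightarrow> 'h \<Rightarrow> complex" where
  "coords_mod N B v =
     (THE c. (\<forall>b. b \<notin> B \<longrightarrow> c b = 0) \<and> v - (\<Sum>b\<in>B. scale (c b) b) \<in> N)"

(* Trace of the endomorphism induced by f on the (finite-dimensional) quotient by the
   f-invariant subspace N; as always for a trace, the choice of the basis is irrelevant. *)
definition trace_mod :: "'h set \<Rightarrow> ('h \<Rightarrow> 'h) \<Rightarrow> complex" where
  "trace_mod N f = (let B = (SOME B. basis_mod N B) in \<Sum>b\<in>B. coords_mod N B (f b) b)"

(* One-dimensional representations, as unital algebra homomorphisms to the complex numbers;
   such a representation coincides with its character. *)
definition one_dim_rep :: "('h \<Rightarrow> complex) \<Rightarrow> bool" where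
  "one_dim_rep \<pi> \<longleftrightarrow> \<pi> 1 = 1 \<and> (\<forall>a b. \<pi> (a + b) = \<pi> a + \<pi> b) \<and>
     (\<forall>c a. \<pi> (scale c a) = c * \<pi> a) \<and> (\<forall>a b. \<pi> (a * b) = \<pi> a * \<pi> b)"

(* Let A be the subalgebra spanned by the powers of the unit x, acting on the line spanned by v
   by x . v = t v.  The induced module, i.e. the tensor product over A of the whole algebra with
   this line, is the quotient of the algebra by the span of all h a - \<psi>(a) h, where a in A acts on
   v by the scalar \<psi>(a); by bilinearity it suffices to let a range over the powers of x.
   The coset of h stands for the tensor of h and v. *)
definition induced_relations :: "'h \<Rightarrow> complex \<Rightarrow> 'h set" where
  "induced_relations x t = span {h * unit_powi x n - scale (t powi n) h | h n. True}"

definition induced_character :: "'h \<Rightarrow> complex \<Rightarrow> 'h \<Rightarrow> complex" where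
  "induced_character x t h = trace_mod (induced_relations x t) (\<lambda>k. h * k)"

end

(* Hecke algebra with parameters qp of the extended Coxeter group W with Coxeter generators S and
   generators \<Omega> of length 0, in the normalisation in which the eigenvalues of T s are
   qp s powr (1/2) and - qp s powr (-1/2). *)
locale hecke_algebra = complex_algebra scale + W: group W
  for scale :: "complex \<Rightarrow> 'h::ring_1 \<Rightarrow> 'h"
    and W :: "'w monoid" (structure) +
  fixes S \<Omega> :: "'w set" and qp :: "'w \<Rightarrow> real" and T :: "'w \<Rightarrow> 'h"
  assumes T_inj: "inj_on T (carrier W)"
    and T_independent: "independent (T ` carrier W)"
    and T_span: "span (T ` carrier W) = UNIV"
    and T_mult: "\<And>u v. u \<in> carrier W \<Longrightarrow> v \<in> carrier W \<Longrightarrow>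
       ext_length W S \<Omega> (u \<otimes> v) = ext_length W S \<Omega> u + ext_length W S \<Omega> v \<Longrightarrow>
       T u * T v = T (u \<otimes> v)"
    and T_quadratic: "\<And>s. s \<in> S \<Longrightarrow>
       T s * T s = 1 + scale (of_real (qp s powr (1/2) - qp s powr (-1/2))) (T s)"
begin

definition Tr :: "'h \<Rightarrow> complex" where
  "Tr h = representation (T ` carrier W) h (T \<one>)"

end

locale hecke_A1_Q = infinite_dihedral W s0 s1 + hecke_algebra scale W "{s0, s1}" "{}" "\<lambda>_. q" T
  for scale :: "complex \<Rightarrow> 'h::ring_1 \<Rightarrow> 'h" and W :: "'w monoid" (structure)
    and s0 s1 :: 'w and q :: real and T :: "'w \<Rightarrow> 'h"

locale hecke_A1_P =
  extended_infinite_dihedral W s0 s1 \<gamma> + hecke_algebra scale W "{s0, s1}" "{\<gamma>}" "\<lambda>_. q" T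
  for scale :: "complex \<Rightarrow> 'h::ring_1 \<Rightarrow> 'h" and W :: "'w monoid" (structure)
    and s0 s1 \<gamma> :: 'w and q :: real and T :: "'w \<Rightarrow> 'h"

locale hecke_BC1_Q =
  infinite_dihedral W s0 s1 +
  hecke_algebra scale W "{s0, s1}" "{}" "\<lambda>s. if s = s0 then q0 else q1" T
  for scale :: "complex \<Rightarrow> 'h::ring_1 \<Rightarrow> 'h" and W :: "'w monoid" (structure)
    and s0 s1 :: 'w and q0 q1 :: real and T :: "'w \<Rightarrow> 'h"

(* Normalised Haar measure of the unit circle, as a Borel measure on the complex plane. *)
definition circle_measure :: "complex measure" where
  "circle_measure = distr (uniform_measure lborel {0..1}) borel (\<lambda>\<theta>. cis (2 * pi * \<theta>))"

(* The finitely many points of the circle where a denominator vanishes form a null set. *)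
definition c_A1_Q :: "real \<Rightarrow> complex \<Rightarrow> complex" where
  "c_A1_Q q t = (1 - of_real (inverse q) * t powi (-1)) / (1 - t powi (-1))"

definition c_A1_P :: "real \<Rightarrow> complex \<Rightarrow> complex" where
  "c_A1_P q t = (1 - of_real (inverse q) * t powi (-2)) / (1 - t powi (-2))"

definition c_BC1_Q :: "real \<Rightarrow> real \<Rightarrow> complex \<Rightarrow> complex" where
  "c_BC1_Q q0 q1 t =
     (1 - of_real (q0 powr (-1/2) * q1 powr (-1/2)) * t powi (-1)) *
     (1 + of_real (q0 powr (1/2) * q1 powr (-1/2)) * t powi (-1)) / (1 - t powi (-2))"

end

(* In all three cases the algebra is generated by T_1 and a second letter (T_0, or T_gamma with
   parameter 1 in the extended case), and the alternating words in these letters form a basis.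
   Both sides of the formula are linear class functions, and such a function is determined by its
   values on T_0, T_1 and the powers x^n with n >= 0, where chi_t(x^n) = t^n + t^(-n). On the unit
   circle 1/|c|^2 expands in partial fractions as q_1 (1 - C_1 P(r) - C_2 P(s)), where r and s are
   the values at x of the one-dimensional representations, C_1 and C_2 are their masses, and P(r)
   is the Poisson kernel, whose n-th Fourier coefficient is r^|n|. Hence the point masses cancel
   exactly the contributions of the two Poisson kernels. *)
theory Submission
  imports Defs "HOL-Probability.Probability_Measure"
begin

section \<open>Traces on quotients of an algebra\<close>

text \<open>The relations of the induced module show at once that 1 and T_1 span it, but not that
  they stay independent. Independence comes from matrices for T_0 and T_1 that satisfy the quadratic
  relations: the basis of words turns them into two linear functionals on the algebra, and these
  kill all relations.

  \<open>Tr\<close> is evaluated directly on words, where only the empty one contributes; the class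
  property is what computes the right-hand side on them.

  The second pole -(q_0/q_1)^(1/2) lies inside the unit disc only if q_0 < q_1. For q_0 > q_1 one
  passes to its inverse, which is the value of chi^3 at x, and the kernel changes sign. This is the
  origin of both the case distinction and the absolute value.

  In terms of A = q_0^(1/2) and B = q_1^(1/2) the three cases are one computation: for A = B the
  second mass vanishes, and for A = 1 both masses equal (q - 1) / (2 (q + 1)).\<close>

context complex_algebra
begin

lemma coords_mod_unique:
  assumes "basis_mod N B" "\<And>b. b \<notin> B \<Longrightarrow> c b = 0" "v - (\<Sum>b\<in>B. scale (c b) b) \<in> N"
  shows "coords_mod N B v = c"
  unfolding coords_mod_def
  by (rule the1_equality) (use assms in \<open>auto simp: basis_mod_def\<close>)

lemma coords_mod:
  assumes "basis_mod N B"
  shows coords_mod_outside: "b \<notin> B \<Longrightarrow> coords_mod N B v b = 0"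
    and coords_mod_congruent: "v - (\<Sum>b\<in>B. scale (coords_mod N B v b) b) \<in> N"
proof -
  have "\<exists>!c. (\<forall>b. b \<notin> B \<longrightarrow> c b = 0) \<and> v - (\<Sum>b\<in>B. scale (c b) b) \<in> N"
    using assms by (auto simp: basis_mod_def)
  from theI'[OF this, folded coords_mod_def]
  show "b \<notin> B \<Longrightarrow> coords_mod N B v b = 0"
    and "v - (\<Sum>b\<in>B. scale (coords_mod N B v b) b) \<in> N" by auto
qed

lemma coords_mod_add:
  assumes N: "subspace N" and B: "basis_mod N B"
  shows "coords_mod N B (v + w) b = coords_mod N B v b + coords_mod N B w b"
proof -
  have "v + w - (\<Sum>b\<in>B. scale (coords_mod N B v b + coords_mod N B w b) b) =
      (v - (\<Sum>b\<in>B. scale (coords_mod N B v b) b)) + (w - (\<Sum>b\<in>B. scale (coords_mod N B w b) b))"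
    by (simp add: scale_left_distrib sum.distrib algebra_simps)
  also have "\<dots> \<in> N"
    using N coords_mod_congruent[OF B] by (intro subspace_add)
  finally have "coords_mod N B (v + w) = (\<lambda>b. coords_mod N B v b + coords_mod N B w b)"
    using coords_mod_outside[OF B] by (intro coords_mod_unique[OF B]) auto
  then show ?thesis by simp
qed

lemma coords_mod_scale:
  assumes N: "subspace N" and B: "basis_mod N B"
  shows "coords_mod N B (scale k v) b = k * coords_mod N B v b"
proof -
  have "scale k v - (\<Sum>b\<in>B. scale (k * coords_mod N B v b) b) =
      scale k (v - (\<Sum>b\<in>B. scale (coords_mod N B v b) b))"
    by (simp add: scale_right_diff_distrib scale_sum_right)
  also have "\<dots> \<in> N"
    using N coords_mod_congruent[OF B] by (intro subspace_scale)
  finally have "coords_mod N B (scale k v) = (\<lambda>b. k * coords_mod N B v b)"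
    using coords_mod_outside[OF B] by (intro coords_mod_unique[OF B]) auto
  then show ?thesis by simp
qed

lemma coords_mod_cong:
  assumes N: "subspace N" and B: "basis_mod N B" and vw: "v - w \<in> N"
  shows "coords_mod N B v = coords_mod N B w"
proof -
  have "v - (\<Sum>b\<in>B. scale (coords_mod N B w b) b) =
      (v - w) + (w - (\<Sum>b\<in>B. scale (coords_mod N B w b) b))"
    by simp
  also have "\<dots> \<in> N"
    using N vw coords_mod_congruent[OF B] by (intro subspace_add)
  finally show ?thesis
    using coords_mod_outside[OF B] by (intro coords_mod_unique[OF B]) auto
qed

lemma coords_mod_sum:
  assumes N: "subspace N" and B: "basis_mod N B"
  shows "coords_mod N B (\<Sum>i\<in>I. scale (k i) (v i)) b = (\<Sum>i\<in>I. k i * coords_mod N B (v i) b)"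
proof (induction I rule: infinite_finite_induct)
  case (insert i I)
  then show ?case
    using coords_mod_add[OF N B] coords_mod_scale[OF N B] by simp
qed (use coords_mod_scale[OF N B, of 0 0] in auto)

text \<open>Base change: expanding \<open>f b\<close> over \<open>C\<close> and then reading
  coordinates over \<open>B\<close> gives a double sum, and summing over \<open>B\<close> first
  yields the trace over \<open>C\<close>. Thus the basis chosen by \<open>SOME\<close> can be
  replaced by a convenient one. Invariance of \<open>N\<close> lets \<open>f\<close> be applied to
  an expansion modulo \<open>N\<close>.\<close>

lemma trace_mod_eq:
  assumes N: "subspace N" and C: "basis_mod N C"
    and f_add: "\<And>v w. f (v + w) = f v + f w" and f_scale: "\<And>k v. f (scale k v) = scale k (f v)"
    and f_N: "\<And>v. v \<in> N \<Longrightarrow> f v \<in> N"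
  shows "trace_mod N f = (\<Sum>b\<in>C. coords_mod N C (f b) b)"
proof -
  define B where "B = (SOME B. basis_mod N B)"
  have B: "basis_mod N B"
    unfolding B_def using C by (rule someI)
  have f_sum: "f (\<Sum>i\<in>I. scale (k i) i) = (\<Sum>i\<in>I. scale (k i) (f i))" for I k
    by (induction I rule: infinite_finite_induct)
      (use f_scale[of 0 0] in \<open>auto simp: f_add f_scale\<close>)
  have expand: "coords_mod N B (f b) b = (\<Sum>e\<in>C. coords_mod N C (f b) e * coords_mod N B e b)" for b
    by (subst coords_mod_cong[OF N B coords_mod_congruent[OF C]]) (rule coords_mod_sum[OF N B])
  have collect: "(\<Sum>b\<in>B. coords_mod N B e b * coords_mod N C (f b) e) = coords_mod N C (f e) e" for e
  proof -
    have "f e - f (\<Sum>b\<in>B. scale (coords_mod N B e b) b) =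
        f (e - (\<Sum>b\<in>B. scale (coords_mod N B e b) b))"
      using f_add[of "e - (\<Sum>b\<in>B. scale (coords_mod N B e b) b)" "\<Sum>b\<in>B. scale (coords_mod N B e b) b"]
      by simp
    also have "\<dots> \<in> N"
      by (intro f_N coords_mod_congruent[OF B])
    finally have "coords_mod N C (f e) = coords_mod N C (\<Sum>b\<in>B. scale (coords_mod N B e b) (f b))"
      unfolding f_sum by (rule coords_mod_cong[OF N C])
    then show ?thesis
      by (simp add: coords_mod_sum[OF N C])
  qed
  have "trace_mod N f = (\<Sum>b\<in>B. \<Sum>e\<in>C. coords_mod N C (f b) e * coords_mod N B e b)"
    by (simp add: trace_mod_def flip: B_def expand)
  also have "\<dots> = (\<Sum>e\<in>C. \<Sum>b\<in>B. coords_mod N B e b * coords_mod N C (f b) e)"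
    by (subst sum.swap) (simp add: mult.commute)
  finally show ?thesis
    by (simp add: collect)
qed

section \<open>Linear class functions\<close>

definition trace_functional :: "('h \<Rightarrow> complex) \<Rightarrow> bool" where
  "trace_functional F \<longleftrightarrow> (\<forall>a b. F (a + b) = F a + F b) \<and> (\<forall>k a. F (scale k a) = k * F a) \<and>
     (\<forall>a b. F (a * b) = F (b * a))"

lemma trace_functionalD:
  assumes "trace_functional F"
  shows "F (a + b) = F a + F b" "F (scale k a) = k * F a" "F (a * b) = F (b * a)"
  using assms unfolding trace_functional_def by blast+

lemma trace_functional_add [intro]:
  "trace_functional F \<Longrightarrow> trace_functional G \<Longrightarrow> trace_functional (\<lambda>h. F h + G h)"
  unfolding trace_functional_def by (simp add: algebra_simps)

lemma trace_functional_cmult [intro]: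
  "trace_functional F \<Longrightarrow> trace_functional (\<lambda>h. k * F h)"
  unfolding trace_functional_def by (simp add: algebra_simps)

lemma trace_functional_zero [intro]: "trace_functional (\<lambda>h. 0)"
  unfolding trace_functional_def by simp

lemma one_dim_rep_trace_functional: "one_dim_rep \<pi> \<Longrightarrow> trace_functional \<pi>"
  unfolding trace_functional_def one_dim_rep_def by (simp add: mult.commute)

lemma one_dim_rep_power: "one_dim_rep \<pi> \<Longrightarrow> \<pi> (a ^ n) = \<pi> a ^ n"
  by (induction n) (auto simp: one_dim_rep_def)

end

section \<open>Algebras with a basis of alternating words\<close>

text \<open>Generic in the operation because the same alternating pattern is needed for products in
  the algebra and in the group, for lists of letters, for total weights, and for matrices applied to
  a vector. The flag selects the first letter; the empty word carries both flags, hence the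
  exceptional case of length 0 in later statements.\<close>

primrec alt_word :: "('a \<Rightarrow> 'b \<Rightarrow> 'b) \<Rightarrow> 'b \<Rightarrow> (bool \<Rightarrow> 'a) \<Rightarrow> nat \<Rightarrow> bool \<Rightarrow> 'b" where
  "alt_word f e g 0 s = e"
| "alt_word f e g (Suc n) s = f (g s) (alt_word f e g n (\<not> s))"

text \<open>The letter \<open>g True\<close> stands for \<open>T\<^sub>1\<close> and \<open>g False\<close> for \<open>T\<^sub>0\<close>, or for \<open>T\<^sub>\<gamma>\<close> in the extended case:
  \<open>\<gamma>\<close> and \<open>s\<^sub>1\<close> also generate an infinite dihedral group, and \<open>\<gamma>\<close> acts as a generator with parameter 1.\<close>

locale dihedral_hecke = complex_algebra scale
  for scale :: "complex \<Rightarrow> 'h::ring_1 \<Rightarrow> 'h" +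
  fixes g :: "bool \<Rightarrow> 'h" and c :: "bool \<Rightarrow> complex"
  assumes quadratic: "g s * g s = 1 + scale (c s) (g s)"
    and words_inj: "alt_word (*) 1 g n s = alt_word (*) 1 g m s' \<Longrightarrow> n = m \<and> (n = 0 \<or> s = s')"
    and words_independent: "independent {b. \<exists>n s. b = alt_word (*) 1 g n s}"
    and words_span: "span {b. \<exists>n s. b = alt_word (*) 1 g n s} = UNIV"
begin

abbreviation E :: "nat \<Rightarrow> bool \<Rightarrow> 'h" where "E \<equiv> alt_word (*) 1 g"

abbreviation x :: 'h where "x \<equiv> g False * g True"

lemma mult_word:
  "g s * E (Suc n) s = E n (\<not> s) + scale (c s) (E (Suc n) s)"
  by (simp add: quadratic distrib_right scale_mult_left flip: mult.assoc)

lemma hecke_induct [case_names one mult add scale]: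
  assumes "P 1" "\<And>s a. P a \<Longrightarrow> P (g s * a)" "\<And>a b. P a \<Longrightarrow> P b \<Longrightarrow> P (a + b)"
    "\<And>k a. P a \<Longrightarrow> P (scale k a)"
  shows "P h"
proof -
  have "P (E n s)" for n s
    by (induction n arbitrary: s) (use assms in auto)
  moreover have "h \<in> span {b. \<exists>n s. b = E n s}"
    by (simp add: words_span)
  then show ?thesis
  proof (induction rule: span_induct_alt)
    case base
    show ?case using assms(4)[OF assms(1), of 0] by simp
  next
    case (step k a b)
    then show ?case
      by (auto intro!: assms(3,4) calculation)
  qed
qed

text \<open>The hypothesis is well-definedness: the empty word is the only basis element with two
  names.\<close>

lemma extend_linear:
  fixes V :: "nat \<Rightarrow> bool \<Rightarrow> complex"
  assumes "V 0 True = V 0 False"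
  obtains f where "\<And>a b. f (a + b) = f a + f b" "\<And>k a. f (scale k a) = k * f a"
    "\<And>n s. f (E n s) = V n s"
proof -
  interpret vector_space_pair scale "(*) :: complex \<Rightarrow> complex \<Rightarrow> complex"
    by unfold_locales (auto simp: algebra_simps)
  define V' where "V' b = (THE v. \<exists>n s. b = E n s \<and> v = V n s)" for b
  have V': "V' (E n s) = V n s" for n s
    unfolding V'_def
  proof (rule the_equality)
    fix v assume "\<exists>m s'. E n s = E m s' \<and> v = V m s'"
    then obtain m s' where "E n s = E m s'" "v = V m s'" by blast
    with words_inj[of n s m s'] assms show "v = V n s" by (cases s; cases s') auto
  qed blast
  obtain f where f: "Vector_Spaces.linear scale (*) f" "\<forall>b\<in>{b. \<exists>n s. b = E n s}. f b = V' b"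
    using linear_independent_extend[OF words_independent] by blast
  then interpret f: Vector_Spaces.linear scale "(*)" f by simp
  show ?thesis
    using f(2) by (intro that[of f]) (auto simp: f.add f.scale simp flip: V')
qed

text \<open>The functionals \<open>u\<close> and \<open>v\<close> are the coordinates in the induced module with respect to the classes of
  \<open>1\<close> and \<open>T\<^sub>1\<close>; there \<open>T\<^sub>0\<close> sends \<open>1\<close> to \<open>t\<^sup>-\<^sup>1 T\<^sub>1 + c False\<close>, because \<open>T\<^sub>0\<^sup>-\<^sup>1 = T\<^sub>1 x\<^sup>-\<^sup>1\<close>.\<close>

lemma two_dim_module:
  assumes t: "t \<noteq> 0"
  obtains u v :: "'h \<Rightarrow> complex" where
    "\<And>a b. u (a + b) = u a + u b" "\<And>k a. u (scale k a) = k * u a"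
    "\<And>a b. v (a + b) = v a + v b" "\<And>k a. v (scale k a) = k * v a"
    "u 1 = 1" "v 1 = 0"
    "\<And>h. u (g True * h) = v h" "\<And>h. v (g True * h) = u h + c True * v h"
    "\<And>h. u (g False * h) = c False * u h + t * v h" "\<And>h. v (g False * h) = u h / t"
proof -
  define M where "M s p = (case p of (y, z) \<Rightarrow>
    if s then (z, y + c True * z) else (c False * y + t * z, y / t))" for s p
  define V where "V = alt_word M (1, 0) id"
  obtain u where u: "\<And>a b. u (a + b) = u a + u b" "\<And>k a. u (scale k a) = k * u a"
    "\<And>n s. u (E n s) = fst (V n s)"
    by (rule extend_linear[of "\<lambda>n s. fst (V n s)"]) (auto simp: V_def)
  obtain v where v: "\<And>a b. v (a + b) = v a + v b" "\<And>k a. v (scale k a) = k * v a"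
    "\<And>n s. v (E n s) = snd (V n s)"
    by (rule extend_linear[of "\<lambda>n s. snd (V n s)"]) (auto simp: V_def)
  have V_Suc: "V (Suc n) s = M s (V n (\<not> s))" for n s
    by (simp add: V_def)
  \<comment> \<open>If the word already starts with \<open>s\<close>, the product is reduced by the
    quadratic relation, which the matrix \<open>M s\<close> satisfies too. Otherwise the product is
    the next longer word and the claim is the recursion for \<open>V\<close>.\<close>
  have word: "(u (g s * E n s'), v (g s * E n s')) = M s (u (E n s'), v (E n s'))" for s n s'
  proof (cases "s' = s \<and> n \<noteq> 0")
    case True
    then obtain m where m: "n = Suc m" "s' = s" by (cases n) auto
    show ?thesis
      unfolding m mult_word u v V_Suc using t
      by (cases "V m (\<not> s)") (auto simp: M_def field_simps)
  next
    case False
    then have "E n s' = E n (\<not> s)" "V n s' = V n (\<not> s)" by (cases n; auto simp: V_def)+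
    moreover have "g s * E n (\<not> s) = E (Suc n) s" by simp
    ultimately show ?thesis
      by (simp only: u v V_Suc) simp
  qed
  have M: "(u (g s * h), v (g s * h)) = M s (u h, v h)" for s h
  proof -
    have "h \<in> span {b. \<exists>n s. b = E n s}"
      by (simp add: words_span)
    then show ?thesis
    proof (induction rule: span_induct_alt)
      case base
      show ?case using u(2)[of 0 0] v(2)[of 0 0] by (simp add: M_def)
    next
      case (step k a b)
      then obtain n s' where a: "a = E n s'" by auto
      have "(u (g s * a), v (g s * a)) = M s (u a, v a)"
        unfolding a by (rule word)
      with step(2) show ?case
        by (auto simp: distrib_left scale_mult_right u(1,2) v(1,2) M_def add_divide_distrib
            algebra_simps split: if_splits)
    qed
  qed
  have one: "u 1 = 1" "v 1 = 0"
    using u(3)[of 0 True] v(3)[of 0 True] by (auto simp: V_def)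
  show ?thesis
    by (rule that[of u v]) (use u(1,2) v(1,2) one M[of True] M[of False] in \<open>auto simp: M_def\<close>)
qed

section \<open>The induced module and its character\<close>

lemma inverse_generator: "g s * (g s - scale (c s) 1) = 1" "(g s - scale (c s) 1) * g s = 1"
  using quadratic[of s]
  by (auto simp: left_diff_distrib right_diff_distrib scale_mult_left scale_mult_right)

definition x_inv :: 'h where
  "x_inv = (g True - scale (c True) 1) * (g False - scale (c False) 1)"

lemma x_inv: "x * x_inv = 1" "x_inv * x = 1"
proof -
  have "x * x_inv = g False * (g True * (g True - scale (c True) 1)) * (g False - scale (c False) 1)"
    by (simp add: x_inv_def mult.assoc)
  then show "x * x_inv = 1" by (simp add: inverse_generator)
  have "x_inv * x = (g True - scale (c True) 1) * ((g False - scale (c False) 1) * g False) * g True"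
    by (simp add: x_inv_def mult.assoc)
  then show "x_inv * x = 1" by (simp add: inverse_generator)
qed

lemma unit_powi_x: "unit_powi x n = (if n \<ge> 0 then x ^ nat n else x_inv ^ nat (- n))"
proof -
  have "(THE y. x * y = 1 \<and> y * x = 1) = x_inv"
  proof (rule the_equality)
    fix y assume "x * y = 1 \<and> y * x = 1"
    then show "y = x_inv"
      by (metis mult.assoc mult_1_left mult_1_right x_inv(1))
  qed (simp add: x_inv)
  then show ?thesis by (simp add: unit_powi_def)
qed

text \<open>This makes left multiplication act on the quotient.\<close>

lemma left_ideal_induced_relations:
  assumes "a \<in> induced_relations y t"
  shows "b * a \<in> induced_relations y t"
  using assms unfolding induced_relations_def
proof (induction rule: span_induct_alt)
  case (step k a a')
  then obtain h n where a: "a = h * unit_powi y n - scale (t powi n) h" by auto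
  have "b * a = (b * h) * unit_powi y n - scale (t powi n) (b * h)"
    by (simp add: a right_diff_distrib scale_mult_right mult.assoc)
  then have "b * a \<in> span {h * unit_powi y n - scale (t powi n) h | h n. True}"
    by (auto intro!: span_base)
  with step show ?case
    by (simp add: distrib_left scale_mult_right span_add span_scale)
qed (simp add: span_zero)

text \<open>The quotient is identified with the explicit module: \<open>u\<close> and
  \<open>v\<close> vanish on the relations, so 1 and T_1 are independent modulo them, while
  \<open>gen\<close> shows that they span. Hence the character is the trace of a 2 by 2 matrix,
  \<open>u h + v (h * g True)\<close>.\<close>

lemma induced_character:
  assumes t: "t \<noteq> 0"
  shows trace_functional_induced_character: "trace_functional (induced_character x t)"
    and induced_character_x_power: "induced_character x t (x ^ n) = t ^ n + inverse t ^ n"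
    and induced_character_generator: "induced_character x t (g s) = c s"
proof -
  obtain u v where lin: "\<And>a b. u (a + b) = u a + u b" "\<And>k a. u (scale k a) = k * u a"
    "\<And>a b. v (a + b) = v a + v b" "\<And>k a. v (scale k a) = k * v a"
    and u_v_one: "u 1 = 1" "v 1 = 0"
    and T: "\<And>h. u (g True * h) = v h" "\<And>h. v (g True * h) = u h + c True * v h"
    "\<And>h. u (g False * h) = c False * u h + t * v h" "\<And>h. v (g False * h) = u h / t"
    using two_dim_module[OF t] by blast
  have minus: "u (a - b) = u a - u b" "v (a - b) = v a - v b" for a b
    using lin(1)[of "a - b" b] lin(3)[of "a - b" b] by (auto simp: algebra_simps)
  define N where "N = induced_relations x t"
  have N: "subspace N"
    unfolding N_def induced_relations_def by (rule subspace_span)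
  have ideal: "b * a \<in> N" if "a \<in> N" for a b
    using that unfolding N_def by (rule left_ideal_induced_relations)
  \<comment> \<open>Prepending a generator acts on the pair (\<open>u\<close>, \<open>v\<close>) by
    a fixed matrix, so the claim for all \<open>h\<close> reduces to \<open>h = 1\<close>, where it
    says that the class of 1 is an eigenvector of x with eigenvalue t.\<close>
  have ux: "u (h * x) = t * u h \<and> v (h * x) = t * v h" for h
  proof (induction h rule: hecke_induct)
    case one
    have "v (g True) = 1" "u (g True) = 0"
      using T(1,2)[of 1] u_v_one by auto
    then show ?case using t u_v_one by (simp add: T)
  next
    case (mult s a)
    then show ?case using t by (cases s) (auto simp: T mult.assoc algebra_simps)
  qed (auto simp: distrib_right scale_mult_left lin algebra_simps)
  have uxi: "u (h * x_inv) = inverse t * u h \<and> v (h * x_inv) = inverse t * v h" for h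
    using ux[of "h * x_inv"] t by (simp add: mult.assoc x_inv field_simps)
  have ux_pow: "u (h * x ^ n) = t ^ n * u h \<and> v (h * x ^ n) = t ^ n * v h" for h n
  proof (induction n)
    case (Suc n)
    then show ?case using ux[of "h * x ^ n"] by (simp add: power_Suc2 mult.assoc del: power_Suc)
  qed simp
  have uxi_pow: "u (h * x_inv ^ n) = inverse t ^ n * u h \<and> v (h * x_inv ^ n) = inverse t ^ n * v h" for h n
  proof (induction n)
    case (Suc n)
    then show ?case using uxi[of "h * x_inv ^ n"]
      by (simp add: power_Suc2 mult.assoc del: power_Suc)
  qed simp
  have N0: "u a = 0 \<and> v a = 0" if "a \<in> N" for a
    using that unfolding N_def induced_relations_def
  proof (induction rule: span_induct_alt)
    case base
    then show ?case using lin(2)[of 0 0] lin(4)[of 0 0] by simp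
  next
    case (step k a b)
    then obtain h n where a: "a = h * unit_powi x n - scale (t powi n) h" by auto
    have "u a = 0 \<and> v a = 0"
      unfolding a by (auto simp: minus lin unit_powi_x ux_pow uxi_pow power_int_def)
    with step show ?case by (simp add: lin)
  qed
  have rel: "h * x - scale t h \<in> N" "h * x_inv - scale (inverse t) h \<in> N" for h
  proof -
    have "h * unit_powi x n - scale (t powi n) h \<in> N" for n
      unfolding N_def induced_relations_def by (intro span_base) auto
    from this[of 1] this[of "-1"] show "h * x - scale t h \<in> N" "h * x_inv - scale (inverse t) h \<in> N"
      by (auto simp: unit_powi_x)
  qed
  have gen: "h - (scale (u h) 1 + scale (v h) (g True)) \<in> N" for h
  proof (induction h rule: hecke_induct)
    case one
    then show ?case using N by (simp add: u_v_one subspace_0)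
  next
    case (mult s a)
    let ?r = "a - (scale (u a) 1 + scale (v a) (g True))"
    have r: "g s * ?r \<in> N" using mult by (rule ideal)
    show ?case
    proof (cases s)
      case True
      have "g s * a - (scale (u (g s * a)) 1 + scale (v (g s * a)) (g True)) = g s * ?r"
        using True by (simp add: T right_diff_distrib distrib_left scale_mult_right quadratic
            scale_left_distrib scale_right_distrib mult.commute)
      with r show ?thesis by simp
    next
      case False
      have "g False = g True * x_inv + scale (c False) 1"
        by (simp add: x_inv_def inverse_generator flip: mult.assoc)
      then have 0: "g True * x_inv = g False - scale (c False) 1" by simp
      \<comment> \<open>Since T_0 T_1 = x and \<open>g False - scale (c False) 1\<close> is
        \<open>g True * x_inv\<close>, the two correction terms are themselves defining
        relations.\<close>
      have "g s * a - (scale (u (g s * a)) 1 + scale (v (g s * a)) (g True))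
          = g s * ?r + scale (v a) (1 * x - scale t 1)
            + scale (u a) (g True * x_inv - scale (inverse t) (g True))"
        unfolding 0 using False by (simp add: T right_diff_distrib distrib_left scale_mult_right
            scale_left_distrib scale_right_distrib scale_right_diff_distrib mult.commute field_simps)
      also have "\<dots> \<in> N"
        using N r rel(1)[of 1] rel(2)[of "g True"] by (intro subspace_add subspace_scale) auto
      finally show ?thesis .
    qed
  next
    case (add a b)
    have "a + b - (scale (u (a + b)) 1 + scale (v (a + b)) (g True)) =
        (a - (scale (u a) 1 + scale (v a) (g True))) + (b - (scale (u b) 1 + scale (v b) (g True)))"
      by (simp add: lin scale_left_distrib)
    with add N show ?case by (simp only: subspace_add)
  next
    case (scale k a)
    have "scale k a - (scale (u (scale k a)) 1 + scale (v (scale k a)) (g True)) =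
        scale k (a - (scale (u a) 1 + scale (v a) (g True)))"
      by (simp add: lin scale_right_diff_distrib scale_right_distrib)
    with scale N show ?case by (simp only: subspace_scale)
  qed
  have g1: "u (g True) = 0" "v (g True) = 1"
    using T(1,2)[of 1] u_v_one by auto
  have g0: "u (g False) = c False" "v (g False) = inverse t"
    using T(3,4)[of 1] u_v_one by (auto simp: field_simps)
  have ne: "g True \<noteq> 1" using g1 u_v_one by auto
  have basis: "basis_mod N {1, g True}"
    unfolding basis_mod_def
  proof (intro conjI allI)
    fix h
    show "\<exists>!d. (\<forall>b. b \<notin> {1, g True} \<longrightarrow> d b = 0) \<and> h - (\<Sum>b\<in>{1, g True}. scale (d b) b) \<in> N"
    proof (rule ex1I[of _ "\<lambda>b. if b = 1 then u h else if b = g True then v h else 0"])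
      show "(\<forall>b. b \<notin> {1, g True} \<longrightarrow> (if b = 1 then u h else if b = g True then v h else 0) = 0) \<and>
        h - (\<Sum>b\<in>{1, g True}. scale (if b = 1 then u h else if b = g True then v h else 0) b) \<in> N"
        using gen[of h] ne by auto
    next
      fix d assume d: "(\<forall>b. b \<notin> {1, g True} \<longrightarrow> d b = 0) \<and> h - (\<Sum>b\<in>{1, g True}. scale (d b) b) \<in> N"
      then have "h - (scale (d 1) 1 + scale (d (g True)) (g True)) \<in> N" using ne by auto
      from N0[OF this] have "u h = d 1" "v h = d (g True)"
        by (auto simp: minus lin u_v_one g1)
      with d show "d = (\<lambda>b. if b = 1 then u h else if b = g True then v h else 0)"
        by auto
    qed
  qed simp
  have coords: "coords_mod N {1, g True} h = (\<lambda>b. if b = 1 then u h else if b = g True then v h else 0)" for h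
    by (rule coords_mod_unique[OF basis]) (use gen[of h] ne in auto)
  have chi: "induced_character x t h = u h + v (h * g True)" for h
  proof -
    have "induced_character x t h = (\<Sum>b\<in>{1, g True}. coords_mod N {1, g True} (h * b) b)"
      unfolding induced_character_def N_def[symmetric]
      by (rule trace_mod_eq[OF N basis]) (auto simp: distrib_left scale_mult_right ideal)
    then show ?thesis using ne by (auto simp: coords)
  qed
  \<comment> \<open>Reducing \<open>b\<close> modulo the left ideal \<open>N\<close> shows that
    products go to matrix products; the class property is then the symmetry of the trace of a
    product of two matrices.\<close>
  have mult: "u (a * b) = u b * u a + v b * u (a * g True)" "v (a * b) = u b * v a + v b * v (a * g True)" for a b
    using N0[OF ideal[OF gen[of b], of a]]
    by (auto simp: right_diff_distrib distrib_left scale_mult_right minus lin)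
  show "trace_functional (induced_character x t)"
    unfolding trace_functional_def
  proof (intro conjI allI)
    fix a b
    have "induced_character x t (a * b) = u b * u a + v b * u (a * g True)
      + (u (b * g True) * v a + v (b * g True) * v (a * g True))" for a b
      unfolding chi by (simp add: mult[of a b] mult[of a "b * g True"] mult.assoc)
    then show "induced_character x t (a * b) = induced_character x t (b * a)"
      by simp
  qed (auto simp: chi lin distrib_right scale_mult_left algebra_simps)
  \<comment> \<open>In the basis 1, T_1 the matrix of x is triangular with diagonal entries t and
    1/t. The entry t comes from \<open>ux_pow\<close>, the other one from here.\<close>
  have v_x: "v (x ^ n * h) = inverse t ^ n * v h" for h
    by (induction n) (auto simp: T mult.assoc field_simps)
  show "induced_character x t (x ^ n) = t ^ n + inverse t ^ n"
    using v_x[of "g True"] ux_pow[of 1 n] by (simp add: chi u_v_one g1)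
  show "induced_character x t (g s) = c s"
    by (cases s) (simp_all add: chi T g1 g0)
qed

section \<open>Class functions on alternating words\<close>

lemma word_append: "E n s * g (if even n then s else \<not> s) = E (Suc n) s"
proof (induction n arbitrary: s)
  case (Suc n)
  from Suc[of "\<not> s"] show ?case
    by (cases "even n") (simp_all add: mult.assoc)
qed simp

lemma word_even_False: "E (2 * n) False = x ^ n"
  by (induction n) (simp_all add: mult.assoc)

text \<open>An even word starting with T_1 ends with T_0; moving its first letter to the end
  produces the power of x.\<close>

lemma trace_functional_even_word:
  assumes F: "trace_functional F"
  shows "F (E (2 * n) s) = F (x ^ n)"
proof (cases n)
  case (Suc m)
  have "F (E (Suc (Suc (2 * m))) True) = F (g True * E (Suc (2 * m)) False)"
    by simp
  also have "\<dots> = F (E (Suc (2 * m)) False * g True)"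
    by (rule trace_functionalD(3)[OF F])
  also have "\<dots> = F (E (2 * n) False)"
    using word_append[of "Suc (2 * m)" False] Suc by (simp del: alt_word.simps)
  finally show ?thesis
    using Suc by (cases s) (simp_all add: mult.assoc flip: word_even_False)
qed simp

text \<open>An odd word starts and ends with the same letter. Cyclic invariance brings the two ends
  together, and the quadratic relation leaves a word shorter by two letters plus a multiple of an
  even word.\<close>

lemma trace_functional_odd_word:
  assumes F: "trace_functional F"
  shows "F (E (Suc (Suc (Suc (2 * n)))) s) = F (E (Suc (2 * n)) (\<not> s)) + c s * F (x ^ Suc n)"
proof -
  let ?w = "E (Suc (2 * n)) (\<not> s)"
  have w: "?w * g s = E (2 * Suc n) (\<not> s)"
    using word_append[of "Suc (2 * n)" "\<not> s"] by (simp del: alt_word.simps)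
  have "F (E (Suc (Suc (Suc (2 * n)))) s) = F (g s * (?w * g s))"
    unfolding w by simp
  also have "\<dots> = F (?w * (g s * g s))"
    by (simp add: trace_functionalD(3)[OF F, of "g s"] mult.assoc)
  also have "\<dots> = F (?w + scale (c s) (?w * g s))"
    by (simp add: quadratic distrib_left scale_mult_right)
  also have "\<dots> = F ?w + c s * F (x ^ Suc n)"
    unfolding w by (simp only: trace_functionalD(1,2)[OF F] trace_functional_even_word[OF F])
  finally show ?thesis .
qed

lemma representation_word:
  "representation {b. \<exists>n s. b = E n s} (E n s) 1 = (if n = 0 then 1 else 0)"
proof -
  have "E n s = 1 \<longleftrightarrow> n = 0"
    using words_inj[of n s 0] by auto
  moreover have "E n s \<in> {b. \<exists>n s. b = E n s}"
    by blast
  ultimately show ?thesis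
    by (simp add: representation_basis[OF words_independent])
qed

lemma word_span_induct [case_names word add scale]:
  assumes "\<And>n s. P (E n s)" "\<And>a b. P a \<Longrightarrow> P b \<Longrightarrow> P (a + b)" "\<And>k a. P a \<Longrightarrow> P (scale k a)"
  shows "P h"
proof -
  have "h \<in> span {b. \<exists>n s. b = E n s}"
    by (simp add: words_span)
  then show ?thesis
  proof (induction rule: span_induct_alt)
    case base
    show ?case using assms(3)[OF assms(1), of 0] by simp
  next
    case (step k a b)
    then show ?case
      using assms by auto
  qed
qed

text \<open>Conjugating by a generator shortens odd words and reverses even ones, so linear class functions
  are determined by their values on the powers of x and on the two generators.\<close>

lemma trace_formula:
  fixes w :: "'a \<Rightarrow> complex" and z :: "'a \<Rightarrow> complex"
  assumes z: "\<And>t. t \<in> space M \<Longrightarrow> z t \<noteq> 0"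
    and int_w: "integrable M w"
    and int: "\<And>n. integrable M (\<lambda>t. (z t ^ n + inverse (z t) ^ n) * w t)"
    and D: "trace_functional D"
    and powers: "\<And>n. k * (\<integral>t. (z t ^ n + inverse (z t) ^ n) * w t \<partial>M) + D (x ^ n) = (if n = 0 then 1 else 0)"
    and generators: "\<And>s. k * c s * (\<integral>t. w t \<partial>M) + D (g s) = 0"
  shows "representation {b. \<exists>n s. b = E n s} h 1 = k * (\<integral>t. induced_character x (z t) h * w t \<partial>M) + D h"
proof -
  note chi = trace_functional_induced_character[OF z]
  have powers_int: "integrable M (\<lambda>t. induced_character x (z t) (x ^ n) * w t)"
    and powers_eq: "(\<integral>t. induced_character x (z t) (x ^ n) * w t \<partial>M)
      = (\<integral>t. (z t ^ n + inverse (z t) ^ n) * w t \<partial>M)" for n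
  proof -
    have "integrable M (\<lambda>t. induced_character x (z t) (x ^ n) * w t) =
        integrable M (\<lambda>t. (z t ^ n + inverse (z t) ^ n) * w t)"
      by (rule Bochner_Integration.integrable_cong) (simp_all add: induced_character_x_power z)
    with int show "integrable M (\<lambda>t. induced_character x (z t) (x ^ n) * w t)" by simp
  qed (rule Bochner_Integration.integral_cong, simp_all add: induced_character_x_power z)
  \<comment> \<open>Integrability is carried through the induction: the integral is additive only
    for integrable functions, the others having integral 0 by convention.\<close>
  define P where "P h \<longleftrightarrow> integrable M (\<lambda>t. induced_character x (z t) h * w t) \<and>
    k * (\<integral>t. induced_character x (z t) h * w t \<partial>M) + D h = representation {b. \<exists>n s. b = E n s} h 1" for h
  have even: "P (E (2 * n) s)" for n s
  proof -
    have "integrable M (\<lambda>t. induced_character x (z t) (E (2 * n) s) * w t) =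
        integrable M (\<lambda>t. induced_character x (z t) (x ^ n) * w t)"
      by (rule Bochner_Integration.integrable_cong) (simp_all add: trace_functional_even_word[OF chi])
    moreover have "(\<integral>t. induced_character x (z t) (E (2 * n) s) * w t \<partial>M) =
        (\<integral>t. induced_character x (z t) (x ^ n) * w t \<partial>M)"
      by (rule Bochner_Integration.integral_cong) (simp_all add: trace_functional_even_word[OF chi])
    ultimately show ?thesis
      using powers[of n] powers_int[of n] powers_eq[of n]
      unfolding P_def by (simp add: representation_word trace_functional_even_word[OF D] del: alt_word.simps)
  qed
  have odd: "P (E (Suc (2 * n)) s)" for n s
  proof (induction n arbitrary: s)
    case 0
    have "integrable M (\<lambda>t. induced_character x (z t) (g s) * w t) = integrable M (\<lambda>t. c s * w t)"
      by (rule Bochner_Integration.integrable_cong) (simp_all add: induced_character_generator z)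
    moreover have "(\<integral>t. induced_character x (z t) (g s) * w t \<partial>M) = (\<integral>t. c s * w t \<partial>M)"
      by (rule Bochner_Integration.integral_cong) (simp_all add: induced_character_generator z)
    ultimately show ?case
      using generators[of s] int_w representation_word[of "Suc 0" s]
      unfolding P_def by (simp add: mult.assoc)
  next
    case (Suc n)
    let ?v = "E (Suc (2 * n)) (\<not> s)" and ?u = "E (Suc (2 * Suc n)) s"
    have u: "F ?u = F ?v + c s * F (x ^ Suc n)" if "trace_functional F" for F
      using trace_functional_odd_word[OF that, of n s] by simp
    have int: "integrable M (\<lambda>t. induced_character x (z t) ?v * w t + c s * (induced_character x (z t) (x ^ Suc n) * w t))"
      using Suc[of "\<not> s"] powers_int[of "Suc n"] unfolding P_def
      by (intro Bochner_Integration.integrable_add integrable_mult_right) auto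
    have "integrable M (\<lambda>t. induced_character x (z t) ?u * w t) =
        integrable M (\<lambda>t. induced_character x (z t) ?v * w t + c s * (induced_character x (z t) (x ^ Suc n) * w t))"
      by (rule Bochner_Integration.integrable_cong) (simp_all only: u[OF chi] distrib_right mult.assoc)
    then have int_u: "integrable M (\<lambda>t. induced_character x (z t) ?u * w t)"
      using int by blast
    have "(\<integral>t. induced_character x (z t) ?u * w t \<partial>M) =
        (\<integral>t. induced_character x (z t) ?v * w t + c s * (induced_character x (z t) (x ^ Suc n) * w t) \<partial>M)"
      by (rule Bochner_Integration.integral_cong) (simp_all only: u[OF chi] distrib_right mult.assoc)
    also have "\<dots> = (\<integral>t. induced_character x (z t) ?v * w t \<partial>M) + c s * (\<integral>t. induced_character x (z t) (x ^ Suc n) * w t \<partial>M)"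
      using Suc[of "\<not> s"] powers_int[of "Suc n"] unfolding P_def
      by (subst Bochner_Integration.integral_add) (auto simp del: power_Suc alt_word.simps)
    finally have "k * (\<integral>t. induced_character x (z t) ?u * w t \<partial>M) + D ?u =
        (k * (\<integral>t. induced_character x (z t) ?v * w t \<partial>M) + D ?v)
        + c s * (k * (\<integral>t. induced_character x (z t) (x ^ Suc n) * w t \<partial>M) + D (x ^ Suc n))"
      unfolding u[OF D] by (simp only: algebra_simps)
    \<comment> \<open>Both brackets are instances of the formula at nonempty words, the shorter odd
      word and a positive power of x, where the trace is 0.\<close>
    also have "\<dots> = 0"
      using Suc[of "\<not> s"] powers[of "Suc n", folded powers_eq]
      unfolding P_def representation_word by simp
    finally show ?case
      using int_u unfolding P_def representation_word by simp
  qed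
  have "P h"
  proof (induction h rule: word_span_induct)
    case (word n s)
    show ?case
      using even[of "n div 2" s] odd[of "n div 2" s] by (cases "even n") (auto elim!: evenE oddE simp del: alt_word.simps)
  next
    case (add a b)
    have int: "integrable M (\<lambda>t. induced_character x (z t) a * w t + induced_character x (z t) b * w t)"
      using add unfolding P_def by (intro Bochner_Integration.integrable_add) auto
    have "integrable M (\<lambda>t. induced_character x (z t) (a + b) * w t) =
        integrable M (\<lambda>t. induced_character x (z t) a * w t + induced_character x (z t) b * w t)"
      by (rule Bochner_Integration.integrable_cong) (simp_all only: trace_functionalD[OF chi] distrib_right)
    then have int_ab: "integrable M (\<lambda>t. induced_character x (z t) (a + b) * w t)"
      using int by blast
    have "(\<integral>t. induced_character x (z t) (a + b) * w t \<partial>M) =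
        (\<integral>t. induced_character x (z t) a * w t + induced_character x (z t) b * w t \<partial>M)"
      by (rule Bochner_Integration.integral_cong) (simp_all only: trace_functionalD[OF chi] distrib_right)
    also have "\<dots> = (\<integral>t. induced_character x (z t) a * w t \<partial>M) + (\<integral>t. induced_character x (z t) b * w t \<partial>M)"
      using add unfolding P_def by (intro Bochner_Integration.integral_add) auto
    finally have "k * (\<integral>t. induced_character x (z t) (a + b) * w t \<partial>M) + D (a + b) =
        (k * (\<integral>t. induced_character x (z t) a * w t \<partial>M) + D a) +
        (k * (\<integral>t. induced_character x (z t) b * w t \<partial>M) + D b)"
      by (simp only: trace_functionalD(1)[OF D] algebra_simps)
    also have "\<dots> = representation {b. \<exists>n s. b = E n s} a 1 + representation {b. \<exists>n s. b = E n s} b 1"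
      using add unfolding P_def by simp
    also have "\<dots> = representation {b. \<exists>n s. b = E n s} (a + b) 1"
      by (subst representation_add[OF words_independent]) (simp_all add: words_span)
    finally show ?case
      using int_ab unfolding P_def by blast
  next
    case (scale r a)
    have int: "integrable M (\<lambda>t. r * (induced_character x (z t) a * w t))"
      using scale unfolding P_def by (intro integrable_mult_right) auto
    have "integrable M (\<lambda>t. induced_character x (z t) (scale r a) * w t) =
        integrable M (\<lambda>t. r * (induced_character x (z t) a * w t))"
      by (rule Bochner_Integration.integrable_cong) (simp_all only: trace_functionalD[OF chi] mult.assoc)
    then have int_r: "integrable M (\<lambda>t. induced_character x (z t) (scale r a) * w t)"
      using int by blast
    have "(\<integral>t. induced_character x (z t) (scale r a) * w t \<partial>M) =
        (\<integral>t. r * (induced_character x (z t) a * w t) \<partial>M)"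
      by (rule Bochner_Integration.integral_cong) (simp_all only: trace_functionalD[OF chi] mult.assoc)
    also have "\<dots> = r * (\<integral>t. induced_character x (z t) a * w t \<partial>M)"
      by simp
    finally have "k * (\<integral>t. induced_character x (z t) (scale r a) * w t \<partial>M) + D (scale r a) =
        r * (k * (\<integral>t. induced_character x (z t) a * w t \<partial>M) + D a)"
      by (simp only: trace_functionalD(2)[OF D] algebra_simps)
    also have "\<dots> = r * representation {b. \<exists>n s. b = E n s} a 1"
      using scale unfolding P_def by simp
    also have "\<dots> = representation {b. \<exists>n s. b = E n s} (scale r a) 1"
      by (subst representation_scale[OF words_independent]) (simp_all add: words_span)
    finally show ?case
      using int_r unfolding P_def by blast
  qed
  then show ?thesis
    by (simp add: P_def)
qed

end

section \<open>Fourier coefficients of the Poisson kernel\<close>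

lemma prob_space_circle_measure: "prob_space circle_measure"
  unfolding circle_measure_def
proof (intro prob_space.prob_space_distr prob_space_uniform_measure)
  have "(\<lambda>\<theta>. cis (2 * pi * \<theta>)) \<in> borel_measurable borel"
    by (intro borel_measurable_continuous_onI continuous_intros)
  then show "(\<lambda>\<theta>. cis (2 * pi * \<theta>)) \<in> borel_measurable (uniform_measure lborel {0..1})"
    by simp
qed auto

lemma sets_circle_measure [measurable_cong, simp]: "sets circle_measure = sets borel"
  by (simp add: circle_measure_def)

lemma space_circle_measure [simp]: "space circle_measure = UNIV"
  by (simp add: circle_measure_def)

text \<open>The measure lives on the whole plane, so the unit norm has to be stated. The points 1
  and -1 are the zeros of 1 - t^(-2) on the circle; they come only from the parameters 0, 1/2 and
  1.\<close>

lemma AE_circle_measure: "AE t in circle_measure. cmod t = 1 \<and> t \<noteq> 1 \<and> t \<noteq> -1"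
proof -
  have [measurable]: "(\<lambda>\<theta>. cis (2 * pi * \<theta>)) \<in> borel_measurable borel"
    by (intro borel_measurable_continuous_onI continuous_intros)
  have "AE \<theta> in lborel. \<theta> \<in> {0..1} \<longrightarrow> cis (2 * pi * \<theta>) \<noteq> 1 \<and> cis (2 * pi * \<theta>) \<noteq> -1"
  proof (rule AE_mp[OF AE_lborel_singleton[of 0] AE_mp[OF AE_lborel_singleton[of "1/2"]
          AE_mp[OF AE_lborel_singleton[of 1]]]], rule AE_I2, intro impI)
    fix \<theta> :: real
    assume "\<theta> \<noteq> 0" "\<theta> \<noteq> 1/2" "\<theta> \<noteq> 1" and \<theta>: "\<theta> \<in> {0..1}"
    then have ne: "2 * \<theta> \<noteq> 0" "2 * \<theta> \<noteq> 1" "2 * \<theta> \<noteq> 2" by auto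
    have "sin (2 * pi * \<theta>) \<noteq> 0"
    proof
      assume "sin (2 * pi * \<theta>) = 0"
      then obtain i :: int where "2 * pi * \<theta> = of_int i * pi"
        by (auto simp: sin_zero_iff_int2)
      then have i: "2 * \<theta> = of_int i" by simp
      with \<theta> have "0 \<le> i" "i \<le> 2" by auto
      then have "i = 0 \<or> i = 1 \<or> i = 2" by auto
      with i ne show False by auto
    qed
    then show "cis (2 * pi * \<theta>) \<noteq> 1 \<and> cis (2 * pi * \<theta>) \<noteq> -1"
      by (auto simp: complex_eq_iff)
  qed
  then have "AE \<theta> in uniform_measure lborel {0..1}. cis (2 * pi * \<theta>) \<noteq> 1 \<and> cis (2 * pi * \<theta>) \<noteq> -1"
    by (intro AE_uniform_measureI) auto
  then show ?thesis
    unfolding circle_measure_def by (subst AE_distr_iff) auto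
qed

lemma integral_circle_measure_powi:
  "(\<integral>t. t powi n \<partial>circle_measure) = (if n = 0 then 1 else 0)"
proof -
  have [measurable]: "(\<lambda>\<theta>. cis (2 * pi * \<theta>)) \<in> borel_measurable borel"
    by (intro borel_measurable_continuous_onI continuous_intros)
  have [measurable]: "(\<lambda>t::complex. t powi n) \<in> borel_measurable borel"
    by (simp add: power_int_def)
  have "(\<integral>t. t powi n \<partial>circle_measure) = (\<integral>\<theta>. cis (2 * pi * \<theta>) powi n \<partial>uniform_measure lborel {0..1})"
    unfolding circle_measure_def by (subst integral_distr) auto
  also have "\<dots> = (\<integral>\<theta>. indicator {0..1} \<theta> *\<^sub>R cis (of_int n * (2 * pi * \<theta>)) \<partial>lborel)"
  proof -
    have "uniform_measure lborel {0..1::real} = density lborel (\<lambda>x. ennreal (indicator {0..1} x))"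
      unfolding uniform_measure_def by (intro density_cong) (auto simp: divide_ennreal split: split_indicator)
    moreover have "(\<lambda>\<theta>. cis (of_int n * (2 * pi * \<theta>))) \<in> borel_measurable borel"
      by (intro borel_measurable_continuous_onI continuous_intros)
    ultimately show ?thesis
      by (simp only: cis_power_int) (subst integral_density; auto)
  qed
  also have "\<dots> = (if n = 0 then 1 else 0)"
  proof (cases "n = 0")
    case True
    then show ?thesis by simp
  next
    case False
    let ?F = "\<lambda>\<theta>. cis (of_int n * (2 * pi * \<theta>)) / (\<i> * of_real (of_int n * (2 * pi)))"
    have "(\<integral>\<theta>. indicator {0..1} \<theta> *\<^sub>R cis (of_int n * (2 * pi * \<theta>)) \<partial>lborel) = ?F 1 - ?F 0"
    proof (rule integral_FTC_Icc)
      fix \<theta> :: real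
      show "(?F has_vector_derivative cis (of_int n * (2 * pi * \<theta>))) (at \<theta> within {0..1})"
        unfolding cis_conv_exp using False
        by (auto intro!: derivative_eq_intros has_vector_derivative_real_field simp: field_simps)
    qed (auto intro!: continuous_intros)
    also have "\<dots> = 0"
      using cis_multiple_2pi[of "of_int n"] by (simp add: mult.commute)
    finally show ?thesis using False by simp
  qed
  finally show ?thesis .
qed

lemma integrable_circle_measure_bounded:
  fixes f :: "complex \<Rightarrow> complex"
  assumes "f \<in> borel_measurable borel" "\<And>t. cmod t = 1 \<Longrightarrow> cmod (f t) \<le> B"
  shows "integrable circle_measure f"
proof -
  interpret prob_space circle_measure by (rule prob_space_circle_measure)
  show ?thesis
    by (rule integrable_const_bound[of _ B]) (use assms AE_circle_measure in \<open>auto elim: AE_mp\<close>)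
qed

text \<open>Every real parameter is allowed: \<open>r = 0\<close> gives the constant 1 of the
  partial fraction expansion, and parameters outside the disc occur before inversion.\<close>

definition poisson :: "real \<Rightarrow> complex \<Rightarrow> real" where
  "poisson r t = (1 - r\<^sup>2) / (cmod (1 - of_real r * t))\<^sup>2"

lemma poisson_measurable [measurable]: "poisson r \<in> borel_measurable borel"
  unfolding poisson_def by measurable

lemma one_minus_ge:
  assumes "cmod t = 1"
  shows "cmod (1 - of_real r * t) \<ge> 1 - \<bar>r\<bar>"
  using norm_triangle_ineq2[of 1 "of_real r * t"] assms by (simp add: norm_mult)

lemma integrable_powi_poisson:
  assumes r: "\<bar>r\<bar> < 1"
  shows "integrable circle_measure (\<lambda>t. t powi n * of_real (poisson r t))"
proof (rule integrable_circle_measure_bounded)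
  show "(\<lambda>t. t powi n * of_real (poisson r t)) \<in> borel_measurable borel"
    by (simp add: power_int_def)
  show "cmod (t powi n * of_real (poisson r t)) \<le> (1 - r\<^sup>2) / (1 - \<bar>r\<bar>)\<^sup>2" if "cmod t = 1" for t
  proof -
    have "r\<^sup>2 < 1" using r by (simp add: abs_square_less_1)
    moreover have "0 < cmod (1 - of_real r * t)"
      using one_minus_ge[OF that, of r] r by linarith
    ultimately have "poisson r t \<le> (1 - r\<^sup>2) / (1 - \<bar>r\<bar>)\<^sup>2" "poisson r t \<ge> 0"
      using one_minus_ge[OF that, of r] r
      by (auto simp: poisson_def intro!: divide_left_mono power_mono mult_pos_pos)
    with that show ?thesis
      by (simp add: norm_mult norm_power_int)
  qed
qed

lemma integrable_powi_geometric:
  assumes r: "\<bar>r\<bar> < 1"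
  shows "integrable circle_measure (\<lambda>t. t ^ n / (1 - of_real r * t))"
proof (rule integrable_circle_measure_bounded)
  show "cmod (t ^ n / (1 - of_real r * t)) \<le> 1 / (1 - \<bar>r\<bar>)" if "cmod t = 1" for t
    using one_minus_ge[OF that, of r] r that
    by (auto simp: norm_divide norm_power intro!: divide_left_mono mult_pos_pos)
qed simp

text \<open>The geometric series of 1 / (1 - r t) has only nonnegative frequencies. Instead of
  exchanging sum and integral, one splits off a single term: \<open>J n\<close> is the mean of t^n
  plus r times \<open>J (Suc n)\<close>. For positive indices iteration gives r^k times a bounded
  quantity, which tends to 0.\<close>

lemma integral_powi_geometric:
  assumes r: "\<bar>r\<bar> < 1"
  shows "(\<integral>t. t ^ n / (1 - of_real r * t) \<partial>circle_measure) = (if n = 0 then 1 else 0)"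
proof -
  interpret prob_space circle_measure by (rule prob_space_circle_measure)
  define J where "J n = (\<integral>t. t ^ n / (1 - of_real r * t) \<partial>circle_measure)" for n :: nat
  have J_bound: "cmod (J n) \<le> 1 / (1 - \<bar>r\<bar>)" for n
  proof -
    have "cmod (J n) \<le> (\<integral>t. cmod (t ^ n / (1 - of_real r * t)) \<partial>circle_measure)"
      unfolding J_def by (rule integral_norm_bound)
    also have "\<dots> \<le> (\<integral>t. 1 / (1 - \<bar>r\<bar>) \<partial>circle_measure)"
    proof (rule integral_mono_AE)
      show "AE t in circle_measure. cmod (t ^ n / (1 - of_real r * t)) \<le> 1 / (1 - \<bar>r\<bar>)"
        using AE_circle_measure
      proof eventually_elim
        case (elim t)
        then show ?case
          using one_minus_ge[of t r] r
          by (auto simp: norm_divide norm_power intro!: divide_left_mono mult_pos_pos)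
      qed
    qed (auto intro!: integrable_norm integrable_powi_geometric r)
    finally show ?thesis using prob_space by simp
  qed
  have step: "J n = (if n = 0 then 1 else 0) + of_real r * J (Suc n)" for n
  proof -
    have "J n - of_real r * J (Suc n) =
        (\<integral>t. t ^ n / (1 - of_real r * t) - of_real r * (t ^ Suc n / (1 - of_real r * t)) \<partial>circle_measure)"
      unfolding J_def
      by (simp only: Bochner_Integration.integral_diff[OF integrable_powi_geometric[OF r]
            integrable_mult_right[OF integrable_powi_geometric[OF r]]] integral_mult_right_zero)
    also have "\<dots> = (\<integral>t. t powi (int n) \<partial>circle_measure)"
    proof (rule integral_cong_AE)
      show "AE t in circle_measure. t ^ n / (1 - of_real r * t) - of_real r * (t ^ Suc n / (1 - of_real r * t)) = t powi int n"
        using AE_circle_measure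
      proof eventually_elim
        case (elim t)
        then have "1 - of_real r * t \<noteq> 0" using one_minus_ge[of t r] r by auto
        moreover have "t ^ n / (1 - of_real r * t) - of_real r * (t ^ Suc n / (1 - of_real r * t)) =
            t ^ n * (1 - of_real r * t) / (1 - of_real r * t)"
          by (simp add: diff_divide_distrib algebra_simps)
        ultimately show ?case by simp
      qed
    qed auto
    finally show ?thesis by (simp only: integral_circle_measure_powi) (simp add: algebra_simps)
  qed
  have J_Suc: "J (Suc n) = 0" for n
  proof -
    have "J (Suc n) = of_real r ^ k * J (Suc n + k)" for k
    proof (induction k)
      case (Suc k)
      show ?case
        using step[of "Suc n + k"] by (simp add: Suc mult.assoc)
    qed simp
    then have "cmod (J (Suc n)) \<le> \<bar>r\<bar> ^ k * (1 / (1 - \<bar>r\<bar>))" for k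
      using J_bound[of "Suc n + k"] by (metis mult_left_mono norm_mult norm_of_real norm_power zero_le_power abs_ge_zero)
    moreover have "(\<lambda>k. \<bar>r\<bar> ^ k * (1 / (1 - \<bar>r\<bar>))) \<longlonglongrightarrow> 0"
      using r by (auto intro!: tendsto_mult_left_zero LIMSEQ_power_zero)
    ultimately have "cmod (J (Suc n)) \<le> 0"
      by (intro LIMSEQ_le_const) auto
    then show ?thesis by simp
  qed
  have "J n = (if n = 0 then 1 else 0)"
    using step[of 0] J_Suc by (cases n) simp_all
  then show ?thesis
    by (simp only: J_def)
qed

text \<open>On the circle \<open>(1 - r / t) P(t) = (1 - r\<^sup>2) / (1 - r t)\<close>, which gives a first order recursion for
  the Fourier coefficients.\<close>

lemma integral_powi_poisson:
  assumes r: "\<bar>r\<bar> < 1"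
  shows "(\<integral>t. t powi n * of_real (poisson r t) \<partial>circle_measure) = of_real r ^ nat \<bar>n\<bar>"
proof -
  define K where "K n = (\<integral>t. t powi n * of_real (poisson r t) \<partial>circle_measure)" for n
  have r2: "1 - r\<^sup>2 \<noteq> 0"
    using abs_square_less_1[of r] r by linarith
  have step: "K (int n) - of_real r * K (int n - 1) = (if n = 0 then 1 - of_real r ^ 2 else 0)" for n
  proof -
    have "K (int n) - of_real r * K (int n - 1) =
        (\<integral>t. t powi (int n) * of_real (poisson r t) - of_real r * (t powi (int n - 1) * of_real (poisson r t)) \<partial>circle_measure)"
      unfolding K_def
      by (simp only: Bochner_Integration.integral_diff[OF integrable_powi_poisson[OF r]
            integrable_mult_right[OF integrable_powi_poisson[OF r]]] integral_mult_right_zero)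
    also have "\<dots> = (\<integral>t. (1 - of_real r ^ 2) * (t ^ n / (1 - of_real r * t)) \<partial>circle_measure)"
    proof (rule integral_cong_AE)
      show "AE t in circle_measure. t powi (int n) * of_real (poisson r t) - of_real r * (t powi (int n - 1) * of_real (poisson r t))
          = (1 - of_real r ^ 2) * (t ^ n / (1 - of_real r * t))"
        using AE_circle_measure
      proof eventually_elim
        case (elim t)
        then have "t \<noteq> 0" by auto
        with elim have t: "t \<noteq> 0" "cnj t = 1 / t"
          using complex_norm_square[of t] by (auto simp: field_simps)
        have ne: "1 - of_real r * t \<noteq> 0" "1 - of_real r * cnj t \<noteq> 0"
          using one_minus_ge[of t r] one_minus_ge[of "cnj t" r] r elim by auto
        have "of_real (poisson r t) = (1 - of_real r ^ 2) / ((1 - of_real r * t) * (1 - of_real r * cnj t))"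
          unfolding poisson_def by (simp only: of_real_divide complex_norm_square) simp
        then have "(1 - of_real r * cnj t) * of_real (poisson r t) = (1 - of_real r ^ 2) / (1 - of_real r * t)"
          using ne by simp
        moreover have "t powi (int n) * of_real (poisson r t) - of_real r * (t powi (int n - 1) * of_real (poisson r t))
            = t ^ n * ((1 - of_real r * cnj t) * of_real (poisson r t))"
          using t by (simp add: power_int_diff algebra_simps)
        ultimately show ?case
          by simp
      qed
      show "(\<lambda>t. t powi int n * complex_of_real (poisson r t) -
           complex_of_real r * (t powi (int n - 1) * complex_of_real (poisson r t))) \<in> borel_measurable circle_measure"
        by (simp add: power_int_def)
    qed auto
    also have "\<dots> = (if n = 0 then 1 - of_real r ^ 2 else 0)"
      by (simp only: integral_mult_right_zero integral_powi_geometric[OF r]) simp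
    finally show ?thesis .
  qed
  have K_minus: "K (- n) = cnj (K n)" for n
  proof -
    have "K (- n) = (\<integral>t. cnj (t powi n * of_real (poisson r t)) \<partial>circle_measure)"
      unfolding K_def
    proof (rule integral_cong_AE)
      show "AE t in circle_measure. t powi (- n) * of_real (poisson r t) = cnj (t powi n * of_real (poisson r t))"
        using AE_circle_measure
      proof eventually_elim
        case (elim t)
        then have "t \<noteq> 0" by auto
        with elim have "cnj t = inverse t"
          using complex_norm_square[of t] by (auto simp: field_simps)
        moreover have "cnj (t powi n) = cnj t powi n"
          by (simp add: power_int_def)
        ultimately show ?case
          by (simp add: power_int_minus power_int_inverse)
      qed
    next
      have [measurable]: "cnj \<in> borel_measurable borel"
        by (intro borel_measurable_continuous_onI continuous_intros)
      have [measurable]: "(\<lambda>t::complex. t powi k) \<in> borel_measurable borel" for k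
        by (simp add: power_int_def)
      show "(\<lambda>t. cnj (t powi n * of_real (poisson r t))) \<in> borel_measurable circle_measure"
        "(\<lambda>t. t powi (- n) * of_real (poisson r t)) \<in> borel_measurable circle_measure"
        by measurable
    qed
    then show ?thesis unfolding K_def by (simp only: Bochner_Integration.integral_cnj)
  qed
  have K_nat: "K (int n) = of_real r ^ n * K 0" for n
  proof (induction n)
    case (Suc n)
    then show ?case using step[of "Suc n"] by (simp add: algebra_simps)
  qed simp
  \<comment> \<open>The recursion at 0 involves \<open>K (-1)\<close>. The kernel being real, this
    is the conjugate of \<open>K 1\<close>, hence r times \<open>K 0\<close>, which closes the
    recursion and determines \<open>K 0\<close>.\<close>
  have "cnj (K 0) = K 0" using K_minus[of 0] by simp
  then have "K (-1) = of_real r * K 0" using K_minus[of 1] K_nat[of 1] by simp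
  then have "(1 - of_real r ^ 2) * K 0 = 1 - of_real r ^ 2"
    using step[of 0] by (simp add: algebra_simps power2_eq_square)
  moreover have "complex_of_real (1 - r\<^sup>2) \<noteq> 0"
    using r2 by (simp only: of_real_eq_0_iff not_False_eq_True)
  then have "(1 - of_real r ^ 2 :: complex) \<noteq> 0"
    by (simp only: of_real_diff of_real_1 of_real_power not_False_eq_True)
  ultimately have "K 0 = 1"
    by (metis mult_cancel_left mult.right_neutral)
  then have K: "K (int n) = of_real r ^ n" "K (- int n) = of_real r ^ n" for n
    using K_nat[of n] K_minus[of "int n"] by simp_all
  have "K n = of_real r ^ nat \<bar>n\<bar>"
    using K(1)[of "nat n"] K(2)[of "nat (- n)"] by (cases "n \<ge> 0") simp_all
  then show ?thesis
    by (simp only: K_def)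
qed

section \<open>Alternating words in infinite dihedral groups\<close>

text \<open>The letters need not be Coxeter generators: besides s_0 and s_1, the pair \<gamma> and
  s_1 is an instance.\<close>

locale involution_pair = group W for W (structure) +
  fixes f :: "bool \<Rightarrow> 'a"
  assumes f_carrier: "f s \<in> carrier W" and f_involution: "f s \<otimes> f s = \<one>"
    and f_infinite_order: "n > 0 \<Longrightarrow> (f False \<otimes> f True) [^] (n::nat) \<noteq> \<one>"
begin

abbreviation alt :: "nat \<Rightarrow> bool \<Rightarrow> 'a" where "alt \<equiv> alt_word (\<otimes>) \<one> f"

lemma alt_closed [simp]: "alt n s \<in> carrier W"
  by (induction n arbitrary: s) (auto simp: f_carrier)

lemma f_mult_alt_Suc: "f s \<otimes> alt (Suc n) s = alt n (\<not> s)"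
  by (simp add: f_carrier f_involution flip: m_assoc)

lemma f_cancel: "a \<in> carrier W \<Longrightarrow> f s \<otimes> (f s \<otimes> a) = a"
  by (simp add: f_carrier f_involution flip: m_assoc)

lemma alt_add: "alt (m + n) s = alt m s \<otimes> alt n (if even m then s else \<not> s)"
  by (induction m arbitrary: s) (simp_all add: f_carrier m_assoc)

text \<open>Odd words are palindromes, that is, conjugates of a letter.\<close>

lemma alt_odd_involution: "alt (Suc (2 * n)) s \<otimes> alt (Suc (2 * n)) s = \<one>"
proof (induction n arbitrary: s)
  case (Suc n)
  let ?a = "alt (Suc (2 * n)) (\<not> s)"
  have "alt (Suc (2 * Suc n)) s = f s \<otimes> ?a \<otimes> f s"
    using alt_add[of "Suc (2 * n)" 1 "\<not> s"] by (simp add: f_carrier m_assoc)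
  then have "alt (Suc (2 * Suc n)) s \<otimes> alt (Suc (2 * Suc n)) s = f s \<otimes> (?a \<otimes> ?a) \<otimes> f s"
    by (simp add: f_carrier m_assoc f_cancel del: alt_word.simps)
  then show ?case
    by (simp only: Suc) (simp add: f_carrier f_involution)
qed (simp add: f_carrier f_involution)

lemma alt_double_False: "alt (2 * n) False = (f False \<otimes> f True) [^] n"
proof (induction n)
  case (Suc n)
  have "alt (2 * Suc n) False = (f False \<otimes> f True) \<otimes> (f False \<otimes> f True) [^] n"
    by (simp add: f_carrier m_assoc flip: Suc)
  also have "\<dots> = (f False \<otimes> f True) [^] Suc n"
    by (rule nat_pow_Suc2[symmetric]) (simp add: f_carrier)
  finally show ?case .
qed simp

lemma alt_even_neq_one:
  assumes "n > 0"
  shows "alt (2 * n) s \<noteq> \<one>"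
proof (cases s)
  case True
  show ?thesis
  proof
    assume one: "alt (2 * n) s = \<one>"
    from assms obtain k where k: "2 * n = Suc (Suc (2 * k))" by (cases n) auto
    \<comment> \<open>Conjugation by \<open>f True\<close> moves the leading letter to the end, so
      the word becomes a power of \<open>f False \<otimes> f True\<close>.\<close>
    have "alt (2 * n) False = f True \<otimes> alt (2 * n) True \<otimes> f True"
      using alt_add[of "Suc (2 * k)" 1 False] by (simp add: k f_carrier f_cancel m_assoc)
    with one True have "alt (2 * n) False = \<one>"
      by (simp add: f_carrier f_involution)
    with assms show False
      by (simp add: alt_double_False f_infinite_order)
  qed
qed (use assms in \<open>simp add: alt_double_False f_infinite_order\<close>)

text \<open>If an odd word were trivial, the word of twice its length would equal the odd word with
  the other first letter, an involution; then an even word of four times the length would be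
  trivial.\<close>

lemma alt_eq_one: "alt n s = \<one> \<Longrightarrow> n = 0"
proof (rule ccontr)
  assume n: "alt n s = \<one>" "n \<noteq> 0"
  then have "odd n"
    using alt_even_neq_one[of "n div 2" s] by (auto elim!: evenE)
  then obtain m where m: "n = Suc (2 * m)" by (auto elim!: oddE)
  have "alt (2 * n) s = alt n s \<otimes> alt n (\<not> s)"
    using alt_add[of n n s] \<open>odd n\<close> by (simp add: mult_2)
  then have "alt (2 * n) s = alt n (\<not> s)" using n by simp
  moreover have "alt (2 * (2 * n)) s = alt (2 * n) s \<otimes> alt (2 * n) s"
    using alt_add[of "2 * n" "2 * n" s] by (simp add: mult_2)
  ultimately have "alt (2 * (2 * n)) s = \<one>"
    unfolding m by (simp only: alt_odd_involution)
  with alt_even_neq_one[of "2 * n" s] n show False by simp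
qed

text \<open>Letters are moved one at a time from the right word to the left one, where they do not
  cancel; the total length is kept, and in the end a single word equals the identity.\<close>

lemma alt_eq_alt_not: "alt n s = alt m (\<not> s) \<Longrightarrow> n + m = 0"
proof (induction m arbitrary: n s)
  case 0
  then show ?case using alt_eq_one by simp
next
  case (Suc m)
  have "alt (Suc n) (\<not> s) = f (\<not> s) \<otimes> alt n s" by simp
  also have "\<dots> = alt m s"
    unfolding Suc.prems by (simp only: f_mult_alt_Suc not_not)
  finally have "Suc n + m = 0" by (intro Suc.IH[of _ "\<not> s"]) simp
  then show ?case by simp
qed

lemma alt_inj: "alt n s = alt m s' \<Longrightarrow> n = m \<and> (n = 0 \<or> s = s')"
proof (cases "s' = s")
  case True
  have "n = m" if "alt n s = alt m s" for n m s
    using that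
  proof (induction n arbitrary: m s)
    case 0
    then show ?case using alt_eq_one[of m s] by simp
  next
    case (Suc n)
    show ?case
    proof (cases m)
      case 0
      with Suc.prems show ?thesis using alt_eq_one[of "Suc n" s] by simp
    next
      case (Suc m')
      with Suc.prems have "alt n (\<not> s) = alt m' (\<not> s)"
        by (simp add: f_carrier)
      with Suc.IH Suc show ?thesis by simp
    qed
  qed
  then show "alt n s = alt m s' \<Longrightarrow> ?thesis" using True by simp
next
  case False
  then have "s' = (\<not> s)" by auto
  then show "alt n s = alt m s' \<Longrightarrow> ?thesis" using alt_eq_alt_not[of n s m] by simp
qed

text \<open>The set \<open>H\<close> may contain more than the two letters, as s_0 in the extended
  group. The induction is on left multiplication preserving the set of alternating words, a property
  that passes to products.\<close>

lemma generate_alt: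
  assumes H: "\<And>h n s. h \<in> H \<Longrightarrow> h \<in> carrier W \<and> h \<otimes> h = \<one> \<and> (\<exists>m s'. h \<otimes> alt n s = alt m s')"
    and a: "a \<in> generate W H"
  shows "\<exists>n s. a = alt n s"
proof -
  have inv: "inv h = h" if "h \<in> H" for h
    using H[OF that] by (intro inv_equality) auto
  have "a \<in> carrier W \<and> (\<forall>n s. \<exists>m s'. a \<otimes> alt n s = alt m s')"
    using a
  proof (induction rule: generate.induct)
    case one
    then show ?case by auto
  next
    case (incl h)
    then show ?case using H by blast
  next
    case (inv h)
    then show ?case using H \<open>\<And>h. h \<in> H \<Longrightarrow> inv h = h\<close> by metis
  next
    case (eng a b)
    then show ?case by (metis alt_closed m_assoc m_closed)
  qed
  then obtain m s' where "a \<in> carrier W" "a \<otimes> alt 0 True = alt m s'" by blast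
  then show ?thesis by auto
qed

lemma f_mult_alt:
  fixes wt :: "bool \<Rightarrow> nat"
  shows "\<exists>m r. f s \<otimes> alt n s' = alt m r \<and> alt_word (+) 0 wt m r \<le> wt s + alt_word (+) 0 wt n s'"
proof (cases "s = s' \<and> n > 0")
  case True
  then obtain m where "n = Suc m" by (cases n) auto
  with True show ?thesis
    using f_mult_alt_Suc[of s' m] by (intro exI[of _ m] exI[of _ "\<not> s'"]) auto
next
  case False
  then have "n = 0 \<or> s' = (\<not> s)" by auto
  then show ?thesis by (intro exI[of _ "Suc n"] exI[of _ s]) auto
qed

end

text \<open>The weight of a letter is its length, which is 0 for the letters from \<open>\<Omega>\<close>.\<close>

locale weighted_involution_pair = involution_pair +
  fixes S \<Omega> :: "'a set" and wt :: "bool \<Rightarrow> nat"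
  assumes f_letter: "f s \<in> S \<union> \<Omega>" "wt s = (if f s \<in> S then 1 else 0)"
    and letter: "u \<in> S \<union> \<Omega> \<Longrightarrow> \<exists>m s'. u \<otimes> alt n s = alt m s' \<and>
      alt_word (+) 0 wt m s' \<le> (if u \<in> S then 1 else 0) + alt_word (+) 0 wt n s"
begin

text \<open>The alternating word is one expression of this cost. Any other expression folds from the
  right, by \<open>letter\<close>, into an alternating word of no greater weight, and
  \<open>alt_inj\<close> says that it is the same word.\<close>

lemma ext_length_alt: "ext_length W S \<Omega> (alt n s) = alt_word (+) 0 wt n s"
  unfolding ext_length_def
proof (rule Least_equality)
  have fold: "foldr (\<otimes>) (alt_word (#) [] f n s) \<one> = alt n s" for n s
    by (induction n arbitrary: s) auto
  have len: "length (filter (\<lambda>u. u \<in> S) (alt_word (#) [] f n s)) = alt_word (+) 0 wt n s" for n s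
    by (induction n arbitrary: s) (auto simp: f_letter)
  have "set (alt_word (#) [] f n s) \<subseteq> S \<union> \<Omega>" for n s
    by (induction n arbitrary: s) (use f_letter in auto)
  then show "\<exists>ws. set ws \<subseteq> S \<union> \<Omega> \<and> foldr (\<otimes>) ws \<one> = alt n s \<and>
      length (filter (\<lambda>u. u \<in> S) ws) = alt_word (+) 0 wt n s"
    using fold len by blast
next
  have reduce: "\<exists>n s. foldr (\<otimes>) ws \<one> = alt n s \<and> alt_word (+) 0 wt n s \<le> length (filter (\<lambda>u. u \<in> S) ws)"
    if "set ws \<subseteq> S \<union> \<Omega>" for ws
    using that
  proof (induction ws)
    case Nil
    have "foldr (\<otimes>) [] \<one> = alt 0 True" by simp
    then show ?case by (intro exI[of _ 0]) auto
  next
    case (Cons u ws)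
    then obtain n s where ns: "foldr (\<otimes>) ws \<one> = alt n s"
      "alt_word (+) 0 wt n s \<le> length (filter (\<lambda>u. u \<in> S) ws)" by auto
    obtain m s' where "u \<otimes> alt n s = alt m s'"
      "alt_word (+) 0 wt m s' \<le> (if u \<in> S then 1 else 0) + alt_word (+) 0 wt n s"
      using letter[of u n s] Cons.prems by auto
    with ns show ?case by (intro exI[of _ m] exI[of _ s']) (auto split: if_splits)
  qed
  fix k
  assume "\<exists>ws. set ws \<subseteq> S \<union> \<Omega> \<and> foldr (\<otimes>) ws \<one> = alt n s \<and> length (filter (\<lambda>u. u \<in> S) ws) = k"
  then obtain m s' where m: "alt n s = alt m s'" "alt_word (+) 0 wt m s' \<le> k"
    using reduce by metis
  from alt_inj[OF m(1)] have "alt_word (+) 0 wt m s' = alt_word (+) 0 wt n s" by auto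
  with m(2) show "alt_word (+) 0 wt n s \<le> k" by simp
qed

text \<open>Additivity of length is the condition under which \<open>T\<close> is multiplicative, so
  \<open>T\<close> of an alternating word becomes the alternating product in the algebra.\<close>

lemma ext_length_f_mult_alt:
  "ext_length W S \<Omega> (f s \<otimes> alt n (\<not> s)) = ext_length W S \<Omega> (f s) + ext_length W S \<Omega> (alt n (\<not> s))"
  using ext_length_alt[of "Suc n" s] ext_length_alt[of 1 s] ext_length_alt[of n "\<not> s"]
  by (simp add: f_carrier)

end

section \<open>The Plancherel formula\<close>

lemma has_bochner_integral_powi_poisson:
  assumes "\<bar>r\<bar> < 1"
  shows "has_bochner_integral circle_measure (\<lambda>t. t powi n * of_real (poisson r t)) (of_real r ^ nat (abs n))"
  using integrable_powi_poisson[OF assms] integral_powi_poisson[OF assms]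
  by (simp add: has_bochner_integral_iff)

text \<open>When \<open>q\<^sub>0 > q\<^sub>1\<close> this turns the Poisson kernel at the value \<open>\<chi>\<^sup>2(x)\<close>, then outside the disc, into the
  one at \<open>\<chi>\<^sup>3(x)\<close>.\<close>

lemma poisson_inverse:
  assumes t: "cmod t = 1" and s: "s \<noteq> 0"
  shows "poisson (inverse s) t = - poisson s t"
proof -
  have "cmod (1 - of_real s * t) = cmod (of_real s * (1 - of_real (inverse s) * cnj t) * t)"
    using t s complex_norm_square[of t]
    by (subst norm_minus_commute) (simp add: algebra_simps)
  also have "\<dots> = \<bar>s\<bar> * cmod (1 - of_real (inverse s) * t)"
    using t complex_mod_cnj[of "1 - of_real (inverse s) * t"] by (simp add: norm_mult)
  finally have "(cmod (1 - of_real s * t))\<^sup>2 = s\<^sup>2 * (cmod (1 - of_real (inverse s) * t))\<^sup>2"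
    by (simp add: power_mult_distrib)
  then have "poisson s t = (1 - s\<^sup>2) / s\<^sup>2 / (cmod (1 - of_real (inverse s) * t))\<^sup>2"
    by (simp add: poisson_def)
  moreover have "(1 - s\<^sup>2) / s\<^sup>2 = - (1 - (inverse s)\<^sup>2)"
    using s by (simp add: field_simps)
  ultimately have "poisson s t = - ((1 - (inverse s)\<^sup>2) / (cmod (1 - of_real (inverse s) * t))\<^sup>2)"
    by (simp only: minus_divide_left)
  then show ?thesis
    by (simp only: poisson_def[of "inverse s"] minus_minus)
qed

text \<open>The \<open>c\<close>-function of case (3) for \<open>q\<^sub>0 = A\<^sup>2\<close> and \<open>q\<^sub>1 = B\<^sup>2\<close>; the other two cases are \<open>A = B\<close> and
  \<open>A = 1\<close>.\<close>

definition c_sqrt :: "real \<Rightarrow> real \<Rightarrow> complex \<Rightarrow> complex" where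
  "c_sqrt A B t = (1 - of_real (1 / (A * B)) * t powi (-1)) * (1 + of_real (A / B) * t powi (-1)) / (1 - t powi (-2))"

text \<open>On the circle \<open>u\<close> is t + 1/t, the square of |1 - r t| is 1 + r^2 - r u, and
  4 - u^2 is the squared norm of 1 - t^(-2). The two linear factors belong to r = 1/(A B) and r =
  -A/B.\<close>

lemma partial_fractions:
  fixes A B u :: real
  assumes pos: "A > 0" "B > 0"
    and D: "1 + (1 / (A * B))\<^sup>2 - 1 / (A * B) * u \<noteq> 0" "1 + (A / B)\<^sup>2 + A / B * u \<noteq> 0"
  shows "(4 - u\<^sup>2) / ((1 + (1 / (A * B))\<^sup>2 - 1 / (A * B) * u) * (1 + (A / B)\<^sup>2 + A / B * u)) =
    B\<^sup>2 * (1 - (A\<^sup>2 * B\<^sup>2 - 1) / ((A\<^sup>2 + 1) * (B\<^sup>2 + 1)) * ((1 - (1 / (A * B))\<^sup>2) / (1 + (1 / (A * B))\<^sup>2 - 1 / (A * B) * u))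
      - (B\<^sup>2 - A\<^sup>2) / ((A\<^sup>2 + 1) * (B\<^sup>2 + 1)) * ((1 - (A / B)\<^sup>2) / (1 + (A / B)\<^sup>2 + A / B * u)))"
proof -
  define v where "v = A * B * u"
  define e1 where "e1 = A\<^sup>2 * B\<^sup>2 + 1 - v"
  define e2 where "e2 = A\<^sup>2 + B\<^sup>2 + v"
  have D1: "1 + (1 / (A * B))\<^sup>2 - 1 / (A * B) * u = e1 / (A\<^sup>2 * B\<^sup>2)"
    using pos by (simp add: e1_def v_def field_simps power2_eq_square)
  have D2: "1 + (A / B)\<^sup>2 + A / B * u = e2 / B\<^sup>2"
    using pos by (simp add: e2_def v_def field_simps power2_eq_square)
  have e: "e1 \<noteq> 0" "e2 \<noteq> 0"
    using D pos unfolding D1 D2 by auto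
  define N where "N = (A\<^sup>2 + 1) * (B\<^sup>2 + 1)"
  have N: "N \<noteq> 0"
    unfolding N_def by (simp add: add_nonneg_eq_0_iff)
  \<comment> \<open>Here \<open>e1 + e2 = N\<close>, which is where the denominator (q_0 + 1)(q_1 +
    1) comes from. At \<open>e1 = 0\<close> the factor 4 A^2 B^2 - v^2 equals -(A^2 B^2 - 1)^2, and
    at \<open>e2 = 0\<close> it equals -(B^2 - A^2)^2; these are the residues.\<close>
  have key: "N * (4 * A\<^sup>2 * B\<^sup>2 - v\<^sup>2) =
      N * e1 * e2 - (A\<^sup>2 * B\<^sup>2 - 1)\<^sup>2 * e2 - (B\<^sup>2 - A\<^sup>2)\<^sup>2 * e1"
    unfolding N_def e1_def e2_def by (simp add: algebra_simps power2_eq_square)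
  have u: "4 - u\<^sup>2 = (4 * A\<^sup>2 * B\<^sup>2 - v\<^sup>2) / (A\<^sup>2 * B\<^sup>2)"
    using pos by (simp add: v_def field_simps power2_eq_square)
  have "(4 - u\<^sup>2) / (e1 / (A\<^sup>2 * B\<^sup>2) * (e2 / B\<^sup>2)) = B\<^sup>2 * ((4 * A\<^sup>2 * B\<^sup>2 - v\<^sup>2) / (e1 * e2))"
    unfolding u using pos e by (simp add: divide_simps)
  also have "4 * A\<^sup>2 * B\<^sup>2 - v\<^sup>2 = e1 * e2 - (A\<^sup>2 * B\<^sup>2 - 1)\<^sup>2 / N * e2
      - (B\<^sup>2 - A\<^sup>2)\<^sup>2 / N * e1"
    (is "_ = ?R")
  proof -
    have "N * (4 * A\<^sup>2 * B\<^sup>2 - v\<^sup>2) = N * ?R"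
      unfolding key using N by (simp add: right_diff_distrib)
    with N show ?thesis by (metis mult_left_cancel)
  qed
  also have "?R / (e1 * e2) = 1 - (A\<^sup>2 * B\<^sup>2 - 1)\<^sup>2 / N / e1
      - (B\<^sup>2 - A\<^sup>2)\<^sup>2 / N / e2"
    using e by (simp add: diff_divide_distrib)
  also have "(A\<^sup>2 * B\<^sup>2 - 1)\<^sup>2 / N / e1 =
      (A\<^sup>2 * B\<^sup>2 - 1) / N * ((1 - (1 / (A * B))\<^sup>2) / (e1 / (A\<^sup>2 * B\<^sup>2)))"
  proof -
    have "1 - (1 / (A * B))\<^sup>2 = (A\<^sup>2 * B\<^sup>2 - 1) / (A\<^sup>2 * B\<^sup>2)"
      using pos by (simp add: field_simps)
    then show ?thesis using pos by (simp add: power2_eq_square)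
  qed
  also have "(B\<^sup>2 - A\<^sup>2)\<^sup>2 / N / e2 =
      (B\<^sup>2 - A\<^sup>2) / N * ((1 - (A / B)\<^sup>2) / (e2 / B\<^sup>2))"
  proof -
    have "1 - (A / B)\<^sup>2 = (B\<^sup>2 - A\<^sup>2) / B\<^sup>2"
      using pos by (simp add: field_simps)
    then show ?thesis using pos by (simp add: power2_eq_square)
  qed
  finally show ?thesis unfolding D1 D2 N_def .
qed

lemma cmod_c_sqrt:
  assumes pos: "A > 0" "B > 0" "A * B > 1" and t: "cmod t = 1" "t \<noteq> 1" "t \<noteq> -1"
  shows "1 / (cmod (c_sqrt A B t))\<^sup>2 =
    B\<^sup>2 * (1 - (A\<^sup>2 * B\<^sup>2 - 1) / ((A\<^sup>2 + 1) * (B\<^sup>2 + 1)) * poisson (1 / (A * B)) t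
      - (B\<^sup>2 - A\<^sup>2) / ((A\<^sup>2 + 1) * (B\<^sup>2 + 1)) * poisson (- (A / B)) t)"
proof -
  define u where "u = 2 * Re t"
  have t0: "t \<noteq> 0" using t by auto
  have sq: "(Re t)\<^sup>2 + (Im t)\<^sup>2 = 1"
    using t by (metis cmod_power2 one_power2)
  have inv: "t powi (-1) = cnj t"
    using t t0 complex_norm_square[of t] by (simp add: field_simps)
  have lin: "(cmod (1 - of_real r * t))\<^sup>2 = 1 + r\<^sup>2 - r * u"
    "(cmod (1 - of_real r * cnj t))\<^sup>2 = 1 + r\<^sup>2 - r * u" for r
  proof -
    have "r\<^sup>2 * ((Re t)\<^sup>2 + (Im t)\<^sup>2) = r\<^sup>2" by (simp add: sq)
    then show "(cmod (1 - of_real r * t))\<^sup>2 = 1 + r\<^sup>2 - r * u"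
      "(cmod (1 - of_real r * cnj t))\<^sup>2 = 1 + r\<^sup>2 - r * u"
      unfolding cmod_power2 by (simp_all add: u_def power2_eq_square algebra_simps)
  qed
  have Im: "Im t \<noteq> 0"
  proof
    assume "Im t = 0"
    then have "(Re t)\<^sup>2 = 1" using sq by simp
    with \<open>Im t = 0\<close> t show False by (auto simp: power2_eq_1_iff complex_eq_iff)
  qed
  have "t powi (-2) = (cnj t)\<^sup>2"
    using power_int_mult[of t "-1" 2] inv by simp
  moreover have "1 - (cnj t)\<^sup>2 = (t - cnj t) * cnj t"
    using t complex_norm_square[of t] by (simp add: algebra_simps power2_eq_square)
  ultimately have "cmod (1 - t powi (-2)) = 2 * \<bar>Im t\<bar>"
    using t by (simp add: norm_mult complex_diff_cnj)
  then have den: "(cmod (1 - t powi (-2)))\<^sup>2 = 4 - u\<^sup>2"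
    using sq by (simp add: u_def power_mult_distrib)
  have r: "1 / (A * B) < 1" using pos by simp
  have D1: "1 + (1 / (A * B))\<^sup>2 - 1 / (A * B) * u \<noteq> 0"
    unfolding lin(1)[symmetric] using one_minus_ge[OF t(1), of "1 / (A * B)"] r pos by auto
  \<comment> \<open>No bound on A/B is available, and for A = B the pole lies on the circle at -1;
    so nonvanishing is obtained from \<open>Im t \<noteq> 0\<close>.\<close>
  have D2: "1 + (A / B)\<^sup>2 + A / B * u \<noteq> 0"
  proof -
    have "1 - of_real (- (A / B)) * t \<noteq> 0"
      using Im pos by (auto simp: complex_eq_iff)
    then show ?thesis using lin(1)[of "- (A / B)"] by auto
  qed
  have "1 / (cmod (c_sqrt A B t))\<^sup>2 =
      (4 - u\<^sup>2) / ((cmod (1 - of_real (1 / (A * B)) * cnj t))\<^sup>2 * (cmod (1 - of_real (- (A / B)) * cnj t))\<^sup>2)"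
    unfolding c_sqrt_def inv norm_divide power_divide den norm_mult power_mult_distrib by simp
  also have "\<dots> = (4 - u\<^sup>2) / ((1 + (1 / (A * B))\<^sup>2 - 1 / (A * B) * u) * (1 + (A / B)\<^sup>2 + A / B * u))"
    unfolding lin by simp
  also note partial_fractions[OF pos(1,2) D1 D2]
  finally show ?thesis
    unfolding poisson_def lin by simp
qed

section \<open>The Plancherel formula for a weight with two poles\<close>

context dihedral_hecke
begin

text \<open>\<open>D\<close> is the discrete part, with masses \<open>a\<close> at \<open>r\<close>
  and \<open>b\<close> at \<open>s\<close>. The condition \<open>D_generators\<close> is the formula
  at one letter: the character there is the constant \<open>c s\<close>, and 1/d has mean p (1 - a -
  b). The weight is prescribed almost everywhere only, which leaves room for the zeros of
  denominators.\<close>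

lemma plancherel:
  fixes d :: "complex \<Rightarrow> real"
  assumes r: "\<bar>r\<bar> < 1" and s: "\<bar>s\<bar> < 1" and p: "p \<noteq> 0"
    and d [measurable]: "d \<in> borel_measurable borel"
    and weight: "AE t in circle_measure. 1 / d t = p * (1 - a * poisson r t - b * poisson s t)"
    and D: "trace_functional D"
    and D_powers: "\<And>n. D (x ^ n) = of_real a * of_real r ^ n + of_real b * of_real s ^ n"
    and D_generators: "\<And>s. c s * of_real (1 - a - b) / 2 + D (g s) = 0"
  shows "representation {b. \<exists>n s. b = E n s} h 1 =
    1 / (2 * of_real p) * (\<integral>t. induced_character x t h / of_real (d t) \<partial>circle_measure) + D h"
proof -
  define w where "w t = complex_of_real (1 / d t)" for t
  \<comment> \<open>The character is computed for nonzero parameters only; the null set {0} is moved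
    to 1 and restored at the end.\<close>
  define z where "z t = (if t = 0 then 1 else t)" for t :: complex
  have w [measurable]: "w \<in> borel_measurable borel"
    unfolding w_def by measurable
  have z_meas [measurable]: "z \<in> borel_measurable borel"
    unfolding z_def by measurable
  \<comment> \<open>The constant 1 is the kernel at 0, whose Fourier coefficient
    \<open>0 ^ nat (abs n)\<close> is the Kronecker delta.\<close>
  have w_powi: "has_bochner_integral circle_measure (\<lambda>t. t powi n * w t)
      (of_real p * (0 ^ nat (abs n) - of_real a * of_real r ^ nat (abs n) - of_real b * of_real s ^ nat (abs n)))" for n
  proof -
    have "has_bochner_integral circle_measure
        (\<lambda>t. of_real p * (t powi n * of_real (poisson 0 t) - of_real a * (t powi n * of_real (poisson r t))
          - of_real b * (t powi n * of_real (poisson s t))))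
        (of_real p * (of_real 0 ^ nat (abs n) - of_real a * of_real r ^ nat (abs n) - of_real b * of_real s ^ nat (abs n)))"
      by (intro has_bochner_integral_mult_right has_bochner_integral_diff has_bochner_integral_powi_poisson)
        (use r s in auto)
    moreover have "AE t in circle_measure. t powi n * w t =
        of_real p * (t powi n * of_real (poisson 0 t) - of_real a * (t powi n * of_real (poisson r t))
          - of_real b * (t powi n * of_real (poisson s t)))"
      using weight
    proof eventually_elim
      case (elim t)
      show ?case
        unfolding w_def elim by (simp add: poisson_def algebra_simps)
    qed
    ultimately show ?thesis
      by (subst has_bochner_integral_cong_AE) (auto simp: power_int_def)
  qed
  have w_sum: "has_bochner_integral circle_measure (\<lambda>t. (z t ^ n + inverse (z t) ^ n) * w t)
      (2 * of_real p * (0 ^ n - of_real a * of_real r ^ n - of_real b * of_real s ^ n))" for n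
  proof -
    have "has_bochner_integral circle_measure (\<lambda>t. t powi (int n) * w t + t powi (- int n) * w t)
        (of_real p * (0 ^ n - of_real a * of_real r ^ n - of_real b * of_real s ^ n) +
         of_real p * (0 ^ n - of_real a * of_real r ^ n - of_real b * of_real s ^ n))"
      using has_bochner_integral_add[OF w_powi[of "int n"] w_powi[of "- int n"]] by simp
    moreover have "AE t in circle_measure. (z t ^ n + inverse (z t) ^ n) * w t =
        t powi (int n) * w t + t powi (- int n) * w t"
      using AE_circle_measure
    proof eventually_elim
      case (elim t)
      then have "z t = t" by (auto simp: z_def)
      then show ?case by (simp add: power_int_minus power_inverse distrib_right)
    qed
    moreover have [measurable]: "(\<lambda>t::complex. t powi k) \<in> borel_measurable borel" for k
      by (simp add: power_int_def)
    have "(\<lambda>t. (z t ^ n + inverse (z t) ^ n) * w t) \<in> borel_measurable circle_measure"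
      "(\<lambda>t. t powi (int n) * w t + t powi (- int n) * w t) \<in> borel_measurable circle_measure"
      by measurable
    ultimately show ?thesis
      by (simp only: has_bochner_integral_cong_AE mult_2 distrib_right)
  qed
  have "representation {b. \<exists>n s. b = E n s} h 1 =
      1 / (2 * of_real p) * (\<integral>t. induced_character x (z t) h * w t \<partial>circle_measure) + D h"
  proof (rule trace_formula[OF _ _ _ D])
    show "z t \<noteq> 0" for t by (simp add: z_def)
    show "integrable circle_measure w"
      using w_powi[of 0] by (simp add: has_bochner_integral_iff)
    show "integrable circle_measure (\<lambda>t. (z t ^ n + inverse (z t) ^ n) * w t)" for n
      using w_sum[of n] by (simp add: has_bochner_integral_iff)
    show "1 / (2 * of_real p) * (\<integral>t. (z t ^ n + inverse (z t) ^ n) * w t \<partial>circle_measure) + D (x ^ n)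
        = (if n = 0 then 1 else 0)" for n
      using w_sum[of n] p by (simp add: has_bochner_integral_iff D_powers)
    show "1 / (2 * of_real p) * c s * (\<integral>t. w t \<partial>circle_measure) + D (g s) = 0" for s
      using w_powi[of 0] p D_generators[of s] by (simp add: has_bochner_integral_iff)
  qed
  also have "(\<integral>t. induced_character x (z t) h * w t \<partial>circle_measure) =
      (\<integral>t. induced_character x t h / of_real (d t) \<partial>circle_measure)"
  proof (rule integral_discrete_difference[of "{0}"])
    have "AE t in circle_measure. t \<notin> {0}"
      using AE_circle_measure by eventually_elim auto
    then show "emeasure circle_measure {t} = 0" if "t \<in> {0}" for t
      using that by (subst (asm) AE_iff_measurable[of "{0}"]) auto
  qed (auto simp: z_def w_def divide_inverse)
  finally show ?thesis .
qed

text \<open>The hypotheses on \<open>chi2\<close> and \<open>chi3\<close> are conditional so that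
  the first two algebras can fill the slots of representations they do not have with the zero
  function.\<close>

lemma plancherel_sqrt:
  fixes d :: "complex \<Rightarrow> real" and A B :: real
  assumes A: "A > 0" and B: "B > 0" and AB: "A * B > 1"
    and c: "c False = of_real (A - 1 / A)" "c True = of_real (B - 1 / B)"
    and d: "d \<in> borel_measurable borel"
    and weight: "AE t in circle_measure. d t = (cmod (c_sqrt A B t))\<^sup>2"
    and chi1: "one_dim_rep chi1" "chi1 (g True) = - of_real (1 / B)" "chi1 x = of_real (1 / (A * B))"
    and chi2: "A < B \<Longrightarrow> one_dim_rep chi2" "A < B \<Longrightarrow> chi2 (g True) = - of_real (1 / B)"
      "A < B \<Longrightarrow> chi2 x = - of_real (A / B)"
    and chi3: "B < A \<Longrightarrow> one_dim_rep chi3" "B < A \<Longrightarrow> chi3 (g True) = of_real B"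
      "B < A \<Longrightarrow> chi3 x = - of_real (B / A)"
  shows "representation {b. \<exists>n s. b = E n s} h 1 =
    1 / (2 * of_real (B\<^sup>2)) * (\<integral>t. induced_character x t h / of_real (d t) \<partial>circle_measure)
    + of_real ((A\<^sup>2 * B\<^sup>2 - 1) / ((A\<^sup>2 + 1) * (B\<^sup>2 + 1))) * chi1 h
    + of_real (\<bar>A\<^sup>2 - B\<^sup>2\<bar> / ((A\<^sup>2 + 1) * (B\<^sup>2 + 1))) *
        (if A < B then chi2 h else if B < A then chi3 h else 0)"
proof -
  define a where "a = (A\<^sup>2 * B\<^sup>2 - 1) / ((A\<^sup>2 + 1) * (B\<^sup>2 + 1))"
  define b where "b = \<bar>A\<^sup>2 - B\<^sup>2\<bar> / ((A\<^sup>2 + 1) * (B\<^sup>2 + 1))"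
  define chi where "chi h = (if A < B then chi2 h else if B < A then chi3 h else 0)" for h
  \<comment> \<open>The value of the second representation at x. For A = B its mass is 0, and the
    default 0 stays inside the disc.\<close>
  define s where "s = (if A < B then - (A / B) else if B < A then - (B / A) else 0)"
  have g_False: "\<pi> (g False) = \<pi> x / \<pi> (g True)" if "one_dim_rep \<pi>" "\<pi> (g True) \<noteq> 0" for \<pi>
    using that by (simp add: one_dim_rep_def)
  have N: "A\<^sup>2 + 1 > 0" "B\<^sup>2 + 1 > 0" by (auto intro: add_nonneg_pos)
  have b0: "A = B \<Longrightarrow> b = 0" by (simp add: b_def)
  have trace: "trace_functional chi"
    using one_dim_rep_trace_functional[OF chi2(1)] one_dim_rep_trace_functional[OF chi3(1)]
    unfolding chi_def by (cases "A < B"; cases "B < A") auto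
  have "representation {b. \<exists>n s. b = E n s} h 1 =
      1 / (2 * of_real (B\<^sup>2)) * (\<integral>t. induced_character x t h / of_real (d t) \<partial>circle_measure)
      + (of_real a * chi1 h + of_real b * chi h)"
  proof (rule plancherel[of "1 / (A * B)" s])
    show "AE t in circle_measure. 1 / d t = B\<^sup>2 * (1 - a * poisson (1 / (A * B)) t - b * poisson s t)"
      using AE_circle_measure weight
    proof eventually_elim
      case (elim t)
      \<comment> \<open>For B < A the coefficient is negative; inverting the parameter of the kernel
        supplies the compensating sign and replaces the pole of \<open>chi2\<close> by that of
        \<open>chi3\<close>.\<close>
      have "(B\<^sup>2 - A\<^sup>2) / ((A\<^sup>2 + 1) * (B\<^sup>2 + 1)) * poisson (- (A / B)) t = b * poisson s t"
      proof (cases "B < A")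
        case True
        then have "\<bar>A\<^sup>2 - B\<^sup>2\<bar> = A\<^sup>2 - B\<^sup>2"
          using B by (simp add: power_mono)
        moreover have "poisson (- (B / A)) t = - poisson (- (A / B)) t"
          using poisson_inverse[of t "- (A / B)"] elim A B by simp
        ultimately show ?thesis using True
          by (simp add: s_def b_def left_diff_distrib diff_divide_distrib)
      next
        case False
        then have "\<bar>A\<^sup>2 - B\<^sup>2\<bar> = B\<^sup>2 - A\<^sup>2"
          using A by (simp add: power_mono)
        then show ?thesis using False b0 by (cases "A = B") (auto simp: s_def b_def)
      qed
      then show ?case
        using cmod_c_sqrt[OF A B AB, of t] elim by (simp add: a_def)
    qed
    show "trace_functional (\<lambda>h. of_real a * chi1 h + of_real b * chi h)"
      by (intro trace_functional_add trace_functional_cmult trace one_dim_rep_trace_functional[OF chi1(1)])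
    show "of_real a * chi1 (x ^ n) + of_real b * chi (x ^ n) =
        of_real a * of_real (1 / (A * B)) ^ n + of_real b * of_real s ^ n" for n
      using chi1 chi2 chi3 b0 by (auto simp: chi_def s_def one_dim_rep_power)
    show "c s * of_real (1 - a - b) / 2 + (of_real a * chi1 (g s) + of_real b * chi (g s)) = 0" for s
    proof -
      have chi1_0: "chi1 (g False) = - of_real (1 / A)"
        using g_False[OF chi1(1)] chi1(2,3) A B by simp
      \<comment> \<open>The values at T_0 follow from T_0 = x T_1^(-1): -1/A for
        \<open>chi1\<close>, A for \<open>chi2\<close> and -1/A for \<open>chi3\<close>. After
        multiplication by \<open>X * N\<close> both identities are polynomial.\<close>
      have real: "(A - 1 / A) * (1 - a - b) / 2 - a / A + b * (if A < B then A else - 1 / A) = 0"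
        "(B - 1 / B) * (1 - a - b) / 2 - a / B + b * (if B < A then B else - 1 / B) = 0"
      proof -
        define N where "N = (A\<^sup>2 + 1) * (B\<^sup>2 + 1)"
        have N0: "N \<noteq> 0" using N by (simp add: N_def)
        have aN: "a * N = A\<^sup>2 * B\<^sup>2 - 1" and bN: "b * N = \<bar>A\<^sup>2 - B\<^sup>2\<bar>"
          using N0 by (simp_all add: a_def b_def flip: N_def)
        have abs: "\<bar>A\<^sup>2 - B\<^sup>2\<bar> = (if A < B then B\<^sup>2 - A\<^sup>2 else A\<^sup>2 - B\<^sup>2)"
          using A B power_strict_mono[of A B 2] power_mono[of B A 2] by (cases "A < B") simp_all
        have expand: "X * N * ((X - 1 / X) * (1 - a - b) / 2 - a / X + b * e) =
            (X\<^sup>2 - 1) * (N - a * N - b * N) / 2 - a * N + b * N * (X * e)" if "X > 0" for X e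
          using that by (simp add: field_simps power2_eq_square)
        have zero: "y = 0" if "X * N * y = 0" "X > 0" for X y
          using that N0 by simp
        show "(A - 1 / A) * (1 - a - b) / 2 - a / A + b * (if A < B then A else - 1 / A) = 0"
          by (rule zero[OF _ A], unfold expand[OF A] aN bN abs)
            (use A in \<open>simp add: N_def field_simps power2_eq_square\<close>)
        show "(B - 1 / B) * (1 - a - b) / 2 - a / B + b * (if B < A then B else - 1 / B) = 0"
          by (rule zero[OF _ B], unfold expand[OF B] aN bN abs)
            (use B in \<open>simp add: N_def field_simps power2_eq_square\<close>)
      qed
      have chi_0: "of_real b * chi (g False) = of_real (b * (if A < B then A else - 1 / A))"
      proof (cases A B rule: linorder_cases)
        case less
        then show ?thesis
          using g_False[OF chi2(1)] chi2(2,3) B by (simp add: chi_def)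
      next
        case greater
        then show ?thesis
          using g_False[OF chi3(1)] chi3(2,3) B by (simp add: chi_def)
      qed (simp add: b0)
      have chi_1: "of_real b * chi (g True) = of_real (b * (if B < A then B else - 1 / B))"
        using chi2 chi3 b0 by (auto simp: chi_def)
      show ?thesis
      proof (cases s)
        case True
        have "c s * of_real (1 - a - b) / 2 + (of_real a * chi1 (g s) + of_real b * chi (g s)) =
            of_real ((B - 1 / B) * (1 - a - b) / 2 - a / B + b * (if B < A then B else - 1 / B))"
          using True by (simp add: c chi1 chi_1)
        then show ?thesis by (simp only: real) simp
      next
        case False
        have "c s * of_real (1 - a - b) / 2 + (of_real a * chi1 (g s) + of_real b * chi (g s)) =
            of_real ((A - 1 / A) * (1 - a - b) / 2 - a / A + b * (if A < B then A else - 1 / A))"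
          using False by (simp add: c chi1_0 chi_0)
        then show ?thesis by (simp only: real) simp
      qed
    qed
  qed (use A B AB d in \<open>auto simp: s_def\<close>)
  then show ?thesis
    by (simp add: a_def b_def chi_def)
qed

end

section \<open>From the basis \<open>T\<close> to alternating words\<close>

context hecke_algebra
begin

lemma ext_length_one: "ext_length W S \<Omega> \<one> = 0"
  unfolding ext_length_def by (rule Least_eq_0) (auto intro!: exI[of _ "[]"])

text \<open>The identity has length 0, so length additivity makes \<open>T \<one>\<close> a left
  unit on the basis, hence on 1.\<close>

lemma T_one: "T \<one> = 1"
proof -
  have "T \<one> * h = h" for h
  proof -
    have "h \<in> span (T ` carrier W)" by (simp add: T_span)
    then show ?thesis
    proof (induction rule: span_induct_alt)
      case (step k a b)
      then obtain u where "u \<in> carrier W" "a = T u" by auto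
      then have "T \<one> * a = a" using T_mult[of \<one> u] by (simp add: ext_length_one)
      with step show ?case by (simp add: distrib_left scale_mult_right)
    qed simp
  qed
  from this[of 1] show ?thesis by simp
qed

end

text \<open>The coefficients \<open>c\<close> are separate from \<open>qp\<close> because the letter
  \<gamma> lies outside \<open>S\<close>, where \<open>T_quadratic\<close> says nothing.\<close>

locale dihedral_hecke_algebra =
  hecke_algebra scale W S \<Omega> qp T + weighted_involution_pair W f S \<Omega> wt
  for scale :: "complex \<Rightarrow> 'h::ring_1 \<Rightarrow> 'h" and W :: "'w monoid" (structure)
    and S \<Omega> qp and T :: "'w \<Rightarrow> 'h" and f wt +
  fixes c :: "bool \<Rightarrow> complex"
  assumes carrier_alt: "a \<in> carrier W \<Longrightarrow> \<exists>n s. a = alt n s"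
    and T_f_quadratic: "T (f s) * T (f s) = 1 + scale (c s) (T (f s))"
begin

lemma T_alt: "T (alt n s) = alt_word (*) 1 (\<lambda>s. T (f s)) n s"
proof (induction n arbitrary: s)
  case (Suc n)
  have "T (alt (Suc n) s) = T (f s) * T (alt n (\<not> s))"
    using T_mult[of "f s" "alt n (\<not> s)"] ext_length_f_mult_alt[of s n] by (simp add: f_carrier)
  with Suc show ?case by simp
qed (simp add: T_one)

lemma T_carrier: "T ` carrier W = {b. \<exists>n s. b = alt_word (*) 1 (\<lambda>s. T (f s)) n s}"
  unfolding T_alt[symmetric] by (auto intro!: imageI) (metis carrier_alt)

sublocale dihedral_hecke scale "\<lambda>s. T (f s)" c
proof
  fix n m s s'
  assume "alt_word (*) 1 (\<lambda>s. T (f s)) n s = alt_word (*) 1 (\<lambda>s. T (f s)) m s'"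
  then have "alt n s = alt m s'"
    unfolding T_alt[symmetric] using T_inj by (auto dest: inj_onD)
  then show "n = m \<and> (n = 0 \<or> s = s')" by (rule alt_inj)
qed (use T_f_quadratic T_independent T_span in \<open>auto simp: T_carrier\<close>)

lemma Tr_eq: "Tr h = representation {b. \<exists>n s. b = alt_word (*) 1 (\<lambda>s. T (f s)) n s} h 1"
  by (simp add: Tr_def T_one T_carrier)

end

section \<open>Letters and weights for the two groups\<close>

context infinite_dihedral
begin

lemma weighted_involution_pair:
  "weighted_involution_pair W (\<lambda>s. if s then s1 else s0) {s0, s1} {} (\<lambda>_. 1)"
proof -
  let ?f = "\<lambda>s. if s then s1 else s0"
  interpret involution_pair W ?f
    by unfold_locales (use s0_carrier s1_carrier s0_involution s1_involution infinite_order in auto)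
  show ?thesis
  proof
    fix u n s
    assume "u \<in> {s0, s1} \<union> {}"
    then obtain r where u: "u = ?f r" by (auto intro: that[of True] that[of False])
    show "\<exists>m s'. u \<otimes> alt n s = alt m s' \<and>
        alt_word (+) 0 (\<lambda>_. 1) m s' \<le> (if u \<in> {s0, s1} then 1 else 0) + alt_word (+) (0::nat) (\<lambda>_. 1) n s"
      using f_mult_alt[of r n s "\<lambda>_. 1"] unfolding u
      by (cases r) (simp_all only: if_True if_False insert_iff simp_thms)
  qed auto
qed

lemma carrier_alt_word:
  assumes "a \<in> carrier W"
  shows "\<exists>n s. a = alt_word (\<otimes>) \<one> (\<lambda>s. if s then s1 else s0) n s"
proof -
  let ?f = "\<lambda>s. if s then s1 else s0"
  interpret weighted_involution_pair W ?f "{s0, s1}" "{}" "\<lambda>_. 1"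
    by (rule weighted_involution_pair)
  show ?thesis
  proof (rule generate_alt)
    show "a \<in> generate W {s0, s1}" using assms generated by simp
    show "h \<in> carrier W \<and> h \<otimes> h = \<one> \<and> (\<exists>m s'. h \<otimes> alt n s = alt m s')" if "h \<in> {s0, s1}" for h n s
      using that letter[of h n s] s0_carrier s1_carrier s0_involution s1_involution by auto
  qed
qed

end

context extended_infinite_dihedral
begin

lemma s0_eq: "s0 = \<gamma> \<otimes> (s1 \<otimes> \<gamma>)"
proof -
  have "\<gamma> \<otimes> (\<gamma> \<otimes> s0 \<otimes> \<gamma>) \<otimes> \<gamma> = (\<gamma> \<otimes> \<gamma>) \<otimes> s0 \<otimes> (\<gamma> \<otimes> \<gamma>)"
    using gamma_carrier s0_carrier by (simp only: m_assoc m_closed)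
  then show ?thesis
    using gamma_carrier s0_carrier s1_carrier by (simp add: gamma_involution gamma_swaps m_assoc)
qed

text \<open>The element \<gamma> s_1 is a square root of s_0 s_1, which has infinite order.\<close>

lemma gamma_s1_pow_neq_one:
  assumes "n > 0"
  shows "(\<gamma> \<otimes> s1) [^] (n::nat) \<noteq> \<one>"
proof
  assume n: "(\<gamma> \<otimes> s1) [^] n = \<one>"
  have sq: "(\<gamma> \<otimes> s1) [^] (2::nat) = s0 \<otimes> s1"
    using gamma_carrier s1_carrier by (simp add: s0_eq numeral_2_eq_2 m_assoc)
  have "(s0 \<otimes> s1) [^] n = (\<gamma> \<otimes> s1) [^] (2 * n)"
    using gamma_carrier s1_carrier by (simp add: nat_pow_pow flip: sq)
  also have "\<dots> = ((\<gamma> \<otimes> s1) [^] n) [^] (2::nat)"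
    using gamma_carrier s1_carrier by (simp add: nat_pow_pow mult.commute)
  finally show False
    using n infinite_order[OF assms] by simp
qed

lemma gamma_neq: "\<gamma> \<noteq> s0" "\<gamma> \<noteq> s1"
  using gamma_notin generate.incl[of _ "{s0, s1}" W] by blast+

lemma weighted_involution_pair:
  "weighted_involution_pair W (\<lambda>s. if s then s1 else \<gamma>) {s0, s1} {\<gamma>} (\<lambda>s. if s then 1 else 0)"
proof -
  let ?f = "\<lambda>s. if s then s1 else \<gamma>" and ?wt = "\<lambda>s. if s then 1 else 0 :: nat"
  interpret involution_pair W ?f
    by unfold_locales
      (use gamma_carrier s1_carrier gamma_involution s1_involution gamma_s1_pow_neq_one in auto)
  show ?thesis
  proof
    fix u n s
    assume u: "u \<in> {s0, s1} \<union> {\<gamma>}"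
    have step: "\<exists>m s'. ?f r \<otimes> alt n s = alt m s' \<and> alt_word (+) 0 ?wt m s' \<le> ?wt r + alt_word (+) 0 ?wt n s"
      for r n s by (rule f_mult_alt)
    show "\<exists>m s'. u \<otimes> alt n s = alt m s' \<and>
        alt_word (+) 0 ?wt m s' \<le> (if u \<in> {s0, s1} then 1 else 0) + alt_word (+) 0 ?wt n s"
    proof (cases "u = s0")
      case True
      \<comment> \<open>As s_0 is not a letter, it is applied as \<gamma> s_1 \<gamma>; the weights
        0, 1, 0 add up to its length 1.\<close>
      obtain m1 r1 where 1: "\<gamma> \<otimes> alt n s = alt m1 r1" "alt_word (+) 0 ?wt m1 r1 \<le> alt_word (+) 0 ?wt n s"
        using step[of False n s] by auto
      obtain m2 r2 where 2: "s1 \<otimes> alt m1 r1 = alt m2 r2" "alt_word (+) 0 ?wt m2 r2 \<le> 1 + alt_word (+) 0 ?wt m1 r1"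
        using step[of True m1 r1] by auto
      obtain m3 r3 where 3: "\<gamma> \<otimes> alt m2 r2 = alt m3 r3" "alt_word (+) 0 ?wt m3 r3 \<le> alt_word (+) 0 ?wt m2 r2"
        using step[of False m2 r2] by auto
      have "s0 \<otimes> alt n s = alt m3 r3"
        using gamma_carrier s1_carrier by (simp add: s0_eq m_assoc 1 2 3)
      then show ?thesis
        using True 1(2) 2(2) 3(2) by (intro exI[of _ m3] exI[of _ r3]) simp
    next
      case False
      then show ?thesis
        using u step[of True n s] step[of False n s] gamma_neq by auto
    qed
  qed (use gamma_neq in auto)
qed

lemma carrier_alt_word:
  assumes "a \<in> carrier W"
  shows "\<exists>n s. a = alt_word (\<otimes>) \<one> (\<lambda>s. if s then s1 else \<gamma>) n s"
proof -
  let ?f = "\<lambda>s. if s then s1 else \<gamma>"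
  interpret weighted_involution_pair W ?f "{s0, s1}" "{\<gamma>}" "\<lambda>s. if s then 1 else 0"
    by (rule weighted_involution_pair)
  show ?thesis
  proof (rule generate_alt)
    show "a \<in> generate W {s0, s1, \<gamma>}" using assms generated_ext by simp
    show "h \<in> carrier W \<and> h \<otimes> h = \<one> \<and> (\<exists>m s'. h \<otimes> alt n s = alt m s')" if "h \<in> {s0, s1, \<gamma>}" for h n s
      using that letter[of h n s] s0_carrier s1_carrier s0_involution s1_involution
        gamma_carrier gamma_involution by auto
  qed
qed

end

section \<open>The three algebras\<close>

lemma powr_halves:
  fixes q :: real
  assumes "q > 0"
  shows "q powr (1/2) = sqrt q" "q powr (-1/2) = 1 / sqrt q" "q powr (- (1/2)) = 1 / sqrt q"
  using assms powr_minus[of q "1/2"] by (simp_all add: powr_half_sqrt inverse_eq_divide)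

lemma hecke_A1_Q_plancherel:
  fixes scale :: "complex \<Rightarrow> 'h::ring_1 \<Rightarrow> 'h" and W :: "'w monoid" and T :: "'w \<Rightarrow> 'h"
  assumes "hecke_A1_Q scale W s0 s1 q T" and q: "q > 1"
    and chi: "complex_algebra.one_dim_rep scale chi" "chi (T s1) = - of_real (q powr (-1/2))"
      "chi (T s0 * T s1) = of_real (inverse q)"
  shows "hecke_algebra.Tr scale W T h =
    1 / (2 * of_real q) *
      (\<integral>t. complex_algebra.induced_character scale (T s0 * T s1) t h
             / of_real ((cmod (c_A1_Q q t))^2) \<partial>circle_measure)
    + of_real ((q - 1) / (q + 1)) * chi h"
proof -
  interpret hecke_A1_Q scale W s0 s1 q T by fact
  interpret dihedral_hecke_algebra scale W "{s0, s1}" "{}" "\<lambda>_. q" T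
    "\<lambda>s. if s then s1 else s0" "\<lambda>_. 1" "\<lambda>_. of_real (q powr (1/2) - q powr (-1/2))"
    by (intro dihedral_hecke_algebra.intro dihedral_hecke_algebra_axioms.intro
        weighted_involution_pair hecke_algebra_axioms carrier_alt_word) (simp_all add: T_quadratic)
  have "c_A1_Q q \<in> borel_measurable borel"
    unfolding c_A1_Q_def by (simp add: power_int_def)
  then have meas: "(\<lambda>t. (cmod (c_A1_Q q t))\<^sup>2) \<in> borel_measurable borel" by measurable
  have weight: "AE t in circle_measure. (cmod (c_A1_Q q t))\<^sup>2 = (cmod (c_sqrt (sqrt q) (sqrt q) t))\<^sup>2"
    using AE_circle_measure
  proof eventually_elim
    case (elim t)
    then have "t \<noteq> 0" by auto
    \<comment> \<open>For A = B the second numerator factor is 1 + t^(-1), which cancels against 1 -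
      t^(-2) away from t = -1.\<close>
    with elim have "1 + t powi (-1) \<noteq> 0" "1 - t powi (-2) = (1 - t powi (-1)) * (1 + t powi (-1))"
      by (auto simp: field_simps power_int_minus power2_eq_square add_eq_0_iff)
    then have "c_sqrt (sqrt q) (sqrt q) t = c_A1_Q q t"
      using q by (simp add: c_sqrt_def c_A1_Q_def inverse_eq_divide)
    then show ?case by simp
  qed
  have coeff: "(q * q - 1) / ((q + 1) * (q + 1)) = (q - 1) / (q + 1)"
  proof -
    have "q * q - 1 = (q - 1) * (q + 1)" by (simp add: algebra_simps)
    with q show ?thesis by simp
  qed
  show ?thesis
    unfolding Tr_eq
    using plancherel_sqrt[of "sqrt q" "sqrt q" "\<lambda>t. (cmod (c_A1_Q q t))\<^sup>2" chi "\<lambda>_. 0" "\<lambda>_. 0" h]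
      q chi meas weight by (simp add: powr_halves coeff inverse_eq_divide)
qed

lemma hecke_A1_P_plancherel:
  fixes scale :: "complex \<Rightarrow> 'h::ring_1 \<Rightarrow> 'h" and W :: "'w monoid" and T :: "'w \<Rightarrow> 'h"
  assumes "hecke_A1_P scale W s0 s1 \<gamma> q T" and q: "q > 1"
    and chi1: "complex_algebra.one_dim_rep scale chi1" "chi1 (T s1) = - of_real (q powr (-1/2))"
      "chi1 (T \<gamma> * T s1) = of_real (q powr (-1/2))"
    and chi2: "complex_algebra.one_dim_rep scale chi2" "chi2 (T s1) = - of_real (q powr (-1/2))"
      "chi2 (T \<gamma> * T s1) = - of_real (q powr (-1/2))"
  shows "hecke_algebra.Tr scale W T h =
    1 / (2 * of_real q) *
      (\<integral>t. complex_algebra.induced_character scale (T \<gamma> * T s1) t h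
             / of_real ((cmod (c_A1_P q t))^2) \<partial>circle_measure)
    + of_real ((q - 1) / (2 * (q + 1))) * (chi1 h + chi2 h)"
proof -
  interpret hecke_A1_P scale W s0 s1 \<gamma> q T by fact
  interpret wip: weighted_involution_pair W "\<lambda>s. if s then s1 else \<gamma>" "{s0, s1}" "{\<gamma>}" "\<lambda>s. if s then 1 else 0"
    by (rule weighted_involution_pair)
  \<comment> \<open>Having length 0, \<gamma> behaves as a generator with parameter 1: its
    coefficient A - 1/A is 0 for A = 1.\<close>
  have gamma_quadratic: "T \<gamma> * T \<gamma> = 1"
  proof -
    have "ext_length W {s0, s1} {\<gamma>} \<gamma> = 0"
      using wip.ext_length_alt[of 1 False] gamma_carrier by simp
    then show ?thesis
      using T_mult[of \<gamma> \<gamma>] gamma_carrier gamma_involution by (simp add: ext_length_one T_one)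
  qed
  interpret dihedral_hecke_algebra scale W "{s0, s1}" "{\<gamma>}" "\<lambda>_. q" T
    "\<lambda>s. if s then s1 else \<gamma>" "\<lambda>s. if s then 1 else 0"
    "\<lambda>s. if s then of_real (q powr (1/2) - q powr (-1/2)) else 0"
    by (intro dihedral_hecke_algebra.intro dihedral_hecke_algebra_axioms.intro
        weighted_involution_pair hecke_algebra_axioms carrier_alt_word)
      (simp_all add: T_quadratic gamma_quadratic)
  have "c_A1_P q \<in> borel_measurable borel"
    unfolding c_A1_P_def by (simp add: power_int_def)
  then have meas: "(\<lambda>t. (cmod (c_A1_P q t))\<^sup>2) \<in> borel_measurable borel" by measurable
  have weight: "AE t in circle_measure. (cmod (c_A1_P q t))\<^sup>2 = (cmod (c_sqrt 1 (sqrt q) t))\<^sup>2"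
  proof (rule AE_I2)
    fix t :: complex
    \<comment> \<open>For A = 1 the two poles are opposite, so the linear factors combine to a
      difference of squares.\<close>
    have "(1 - of_real (1 / (1 * r)) * y) * (1 + of_real (1 / r) * y) = 1 - of_real ((1 / r)\<^sup>2) * y\<^sup>2"
      for r :: real and y :: complex
      by (simp add: algebra_simps power2_eq_square)
    note this[of "sqrt q" "t powi (-1)"]
    also have "(t powi (-1))\<^sup>2 = t powi (-2)"
      using power_int_mult[of t "-1" 2] by simp
    also have "(1 / sqrt q)\<^sup>2 = inverse q"
      using q by (simp add: power_divide inverse_eq_divide)
    finally have "c_sqrt 1 (sqrt q) t = c_A1_P q t"
      by (simp only: c_sqrt_def c_A1_P_def)
    then show "(cmod (c_A1_P q t))\<^sup>2 = (cmod (c_sqrt 1 (sqrt q) t))\<^sup>2" by simp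
  qed
  show ?thesis
    unfolding Tr_eq
    using plancherel_sqrt[of 1 "sqrt q" "\<lambda>t. (cmod (c_A1_P q t))\<^sup>2" chi1 chi2 "\<lambda>_. 0" h]
      q chi1 chi2 meas weight by (simp add: powr_halves distrib_left)
qed

lemma hecke_BC1_Q_plancherel:
  fixes scale :: "complex \<Rightarrow> 'h::ring_1 \<Rightarrow> 'h" and W :: "'w monoid" and T :: "'w \<Rightarrow> 'h"
  assumes "hecke_BC1_Q scale W s0 s1 q0 q1 T" and q: "q0 > 1" "q1 > 1"
    and chi1: "complex_algebra.one_dim_rep scale chi1" "chi1 (T s1) = - of_real (q1 powr (-1/2))"
      "chi1 (T s0 * T s1) = of_real (q0 powr (-1/2) * q1 powr (-1/2))"
    and chi2: "complex_algebra.one_dim_rep scale chi2" "chi2 (T s1) = - of_real (q1 powr (-1/2))"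
      "chi2 (T s0 * T s1) = - of_real (q0 powr (1/2) * q1 powr (-1/2))"
    and chi3: "complex_algebra.one_dim_rep scale chi3" "chi3 (T s1) = of_real (q1 powr (1/2))"
      "chi3 (T s0 * T s1) = - of_real (q0 powr (-1/2) * q1 powr (1/2))"
  shows "hecke_algebra.Tr scale W T h =
    1 / (2 * of_real q1) *
      (\<integral>t. complex_algebra.induced_character scale (T s0 * T s1) t h
             / of_real ((cmod (c_BC1_Q q0 q1 t))^2) \<partial>circle_measure)
    + of_real ((q0 * q1 - 1) / ((q0 + 1) * (q1 + 1))) * chi1 h
    + of_real (\<bar>q0 - q1\<bar> / ((q0 + 1) * (q1 + 1))) *
        (if q0 < q1 then chi2 h else if q1 < q0 then chi3 h else 0)"
proof -
  interpret hecke_BC1_Q scale W s0 s1 q0 q1 T by fact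
  \<comment> \<open>Otherwise s_0 s_1 would be trivial; this ensures that the parameter at s_1 is
    \<open>q1\<close>.\<close>
  have ne: "s1 \<noteq> s0"
    using infinite_order[of 1] s0_involution s0_carrier by auto
  interpret dihedral_hecke_algebra scale W "{s0, s1}" "{}" "\<lambda>s. if s = s0 then q0 else q1" T
    "\<lambda>s. if s then s1 else s0" "\<lambda>_. 1"
    "\<lambda>s. of_real ((if s then q1 else q0) powr (1/2) - (if s then q1 else q0) powr (-1/2))"
    by (intro dihedral_hecke_algebra.intro dihedral_hecke_algebra_axioms.intro
        weighted_involution_pair hecke_algebra_axioms carrier_alt_word) (simp_all add: T_quadratic ne)
  have "c_BC1_Q q0 q1 \<in> borel_measurable borel"
    unfolding c_BC1_Q_def by (simp add: power_int_def)
  then have meas: "(\<lambda>t. (cmod (c_BC1_Q q0 q1 t))\<^sup>2) \<in> borel_measurable borel" by measurable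
  have "c_BC1_Q q0 q1 = c_sqrt (sqrt q0) (sqrt q1)"
    unfolding c_BC1_Q_def c_sqrt_def fun_eq_iff using q by (simp add: powr_halves)
  then have weight: "AE t in circle_measure. (cmod (c_BC1_Q q0 q1 t))\<^sup>2 = (cmod (c_sqrt (sqrt q0) (sqrt q1) t))\<^sup>2"
    by simp
  have "sqrt q0 * sqrt q1 > 1"
    using q by (intro less_1_mult) auto
  then show ?thesis
    unfolding Tr_eq
    using plancherel_sqrt[of "sqrt q0" "sqrt q1" "\<lambda>t. (cmod (c_BC1_Q q0 q1 t))\<^sup>2" chi1 chi2 chi3 h]
      q chi1 chi2 chi3 meas weight by (simp add: powr_halves)
qed

theorem theorem3p1:
  fixes q q0 q1 :: real
  assumes "q > 1" and "q0 > 1" and "q1 > 1"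
  shows
    "(\<forall>(scale :: complex \<Rightarrow> 'h::ring_1 \<Rightarrow> 'h) (W :: 'w monoid) s0 s1 T chi.
        hecke_A1_Q scale W s0 s1 q T \<and>
        complex_algebra.one_dim_rep scale chi \<and>
        chi (T s1) = - of_real (q powr (-1/2)) \<and>
        chi (T s0 * T s1) = of_real (inverse q)
      \<longrightarrow> (\<forall>h. hecke_algebra.Tr scale W T h =
            1 / (2 * of_real q) *
              (\<integral>t. complex_algebra.induced_character scale (T s0 * T s1) t h
                     / of_real ((cmod (c_A1_Q q t))^2) \<partial>circle_measure)
            + of_real ((q - 1) / (q + 1)) * chi h))
   \<and> (\<forall>(scale :: complex \<Rightarrow> 'h \<Rightarrow> 'h) (W :: 'w monoid) s0 s1 \<gamma> T chi1 chi2.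
        hecke_A1_P scale W s0 s1 \<gamma> q T \<and>
        complex_algebra.one_dim_rep scale chi1 \<and>
        chi1 (T s1) = - of_real (q powr (-1/2)) \<and>
        chi1 (T \<gamma> * T s1) = of_real (q powr (-1/2)) \<and>
        complex_algebra.one_dim_rep scale chi2 \<and>
        chi2 (T s1) = - of_real (q powr (-1/2)) \<and>
        chi2 (T \<gamma> * T s1) = - of_real (q powr (-1/2))
      \<longrightarrow> (\<forall>h. hecke_algebra.Tr scale W T h =
            1 / (2 * of_real q) *
              (\<integral>t. complex_algebra.induced_character scale (T \<gamma> * T s1) t h
                     / of_real ((cmod (c_A1_P q t))^2) \<partial>circle_measure)
            + of_real ((q - 1) / (2 * (q + 1))) * (chi1 h + chi2 h)))
   \<and> (\<forall>(scale :: complex \<Rightarrow> 'h \<Rightarrow> 'h) (W :: 'w monoid) s0 s1 T chi1 chi2 chi3.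
        hecke_BC1_Q scale W s0 s1 q0 q1 T \<and>
        complex_algebra.one_dim_rep scale chi1 \<and>
        chi1 (T s1) = - of_real (q1 powr (-1/2)) \<and>
        chi1 (T s0 * T s1) = of_real (q0 powr (-1/2) * q1 powr (-1/2)) \<and>
        complex_algebra.one_dim_rep scale chi2 \<and>
        chi2 (T s1) = - of_real (q1 powr (-1/2)) \<and>
        chi2 (T s0 * T s1) = - of_real (q0 powr (1/2) * q1 powr (-1/2)) \<and>
        complex_algebra.one_dim_rep scale chi3 \<and>
        chi3 (T s1) = of_real (q1 powr (1/2)) \<and>
        chi3 (T s0 * T s1) = - of_real (q0 powr (-1/2) * q1 powr (1/2))
      \<longrightarrow> (\<forall>h. hecke_algebra.Tr scale W T h =
            1 / (2 * of_real q1) *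
              (\<integral>t. complex_algebra.induced_character scale (T s0 * T s1) t h
                     / of_real ((cmod (c_BC1_Q q0 q1 t))^2) \<partial>circle_measure)
            + of_real ((q0 * q1 - 1) / ((q0 + 1) * (q1 + 1))) * chi1 h
            + of_real (\<bar>q0 - q1\<bar> / ((q0 + 1) * (q1 + 1))) *
                (if q0 < q1 then chi2 h else if q1 < q0 then chi3 h else 0)))"
  by (intro conjI allI impI; elim conjE)
    (intro hecke_A1_Q_plancherel hecke_A1_P_plancherel hecke_BC1_Q_plancherel assms; assumption)+

end
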